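(* Let $E$ and $F$ be order isomorphic quasi-Banach lattices. If $E$ contains a closed sublattice that is (not necessarily linearly) order isomorphic to $c_0$, then $F$ contains a closed sublattice $H$ that is linearly lattice and topologically isomorphic to $c_0$, i.e. there is a linear bijection $R:c_0\to H$ that preserves the lattice operations and is a homeomorphism.
   Context: All lattices are over the reals. $c_0$ is the Banach lattice of real null sequences with the coordinatewise order and the supremum norm. Two ordered vector spaces $E$ and $F$ are order isomorphic if there is a (not necessarily linear) bijection $T:E\to F$ such that, for all $x,y\in E$, $x\ge y$ if and only if $Tx\ge Ty$. A quasi-norm on a vector space $E$ is a functional $\|\cdot\|$ on $E$ such that $\|x\|>0$ if $x\ne 0$; $\|ax\|=|a|\,\|x\|$ for all scalars $a$ and all $x\in E$; and there is a constant $C<\infty$ such that $\|x+y\|\le C\max(\|x\|,\|y\|)$ for all $x,y\in E$. It generates a Hausdorff linear topology in which the sets $\{x:\|x\|<1/n\}$, $n\in\mathbb{N}$, form a neighborhood basis at $0$; the quasi-norm is complete if this topology is completely metrizable. A quasi-Banach lattice is a real vector lattice with a complete quasi-norm such that $|x|\le|y|$ implies $\|x\|\le\|y\|$. A sublattice is a linear subspace closed under the lattice operations $\vee,\wedge$, with the inherited order; "closed" refers to the topology generated by the quasi-norm. *)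

theory Defs
  imports "HOL-Analysis.Analysis" "HOL-Library.Lattice_Algebras"
begin

section \<open>Real vector lattices\<close>

text \<open>
  The superclass \<^class>\<open>lattice_ab_group_add_abs\<close> contributes the lattice operations
  and the law \<^prop>\<open>\<bar>x\<bar> = sup x (- x)\<close>.
\<close>

class vector_lattice = ordered_real_vector + lattice_ab_group_add_abs

definition sublattice :: "'a::vector_lattice set \<Rightarrow> bool"
  where "sublattice H \<longleftrightarrow>
    subspace H \<and> (\<forall>x\<in>H. \<forall>y\<in>H. sup x y \<in> H \<and> inf x y \<in> H)"

definition order_isomorphic :: "'a::order set \<Rightarrow> 'b::order set \<Rightarrow> bool"
  where "order_isomorphic A B \<longleftrightarrow>
    (\<exists>T. bij_betw T A B \<and> (\<forall>x\<in>A. \<forall>y\<in>A. x \<ge> y \<longleftrightarrow> T x \<ge> T y))"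


section \<open>Quasi-norms and quasi-Banach lattices\<close>

locale quasi_norm =
  fixes N :: "'a::real_vector \<Rightarrow> real"
  assumes pos: "x \<noteq> 0 \<Longrightarrow> N x > 0"
    and scale: "N (a *\<^sub>R x) = \<bar>a\<bar> * N x"
    and quasi_triangle: "\<exists>C. \<forall>x y. N (x + y) \<le> C * max (N x) (N y)"

text \<open>
  The balls of a quasi-norm need not be open, so the topology is specified by its
  neighbourhoods; \<open>quasi_norm_ball_neighbourhood\<close> below shows that the balls around a point
  are indeed neighbourhoods of it.
\<close>

definition quasi_norm_topology :: "('a::real_vector \<Rightarrow> real) \<Rightarrow> 'a topology"
  where "quasi_norm_topology N =
    topology (\<lambda>U. \<forall>x\<in>U. \<exists>e>0. {y. N (y - x) < e} \<subseteq> U)"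

lemma openin_quasi_norm_topology:
  "openin (quasi_norm_topology N) U \<longleftrightarrow> (\<forall>x\<in>U. \<exists>e>0. {y. N (y - x) < e} \<subseteq> U)"
proof -
  have "istopology (\<lambda>U. \<forall>x\<in>U. \<exists>e>0. {y. N (y - x) < e} \<subseteq> U)"
    unfolding istopology_def
  proof (rule conjI; intro allI impI ballI)
    fix S T x
    assume "\<forall>x\<in>S. \<exists>e>0. {y. N (y - x) < e} \<subseteq> S"
      "\<forall>x\<in>T. \<exists>e>0. {y. N (y - x) < e} \<subseteq> T" "x \<in> S \<inter> T"
    then obtain d e where "d > 0" "{y. N (y - x) < d} \<subseteq> S" "e > 0" "{y. N (y - x) < e} \<subseteq> T"
      by blast
    then show "\<exists>e>0. {y. N (y - x) < e} \<subseteq> S \<inter> T"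
      by (intro exI[of _ "min d e"]) auto
  next
    fix K x
    assume "\<forall>S\<in>K. \<forall>x\<in>S. \<exists>e>0. {y. N (y - x) < e} \<subseteq> S" "x \<in> \<Union>K"
    then show "\<exists>e>0. {y. N (y - x) < e} \<subseteq> \<Union>K"
      by (meson Sup_upper UnionE subset_trans)
  qed
  then show ?thesis
    by (simp add: quasi_norm_topology_def topology_inverse')
qed

lemma topspace_quasi_norm_topology [simp]: "topspace (quasi_norm_topology N) = UNIV"
proof -
  have "openin (quasi_norm_topology N) UNIV"
    by (auto simp: openin_quasi_norm_topology intro: zero_less_one)
  then show ?thesis
    using openin_subset by blast
qed

lemma (in quasi_norm) zero [simp]: "N 0 = 0"
  using scale[of 0 0] by simp

lemma (in quasi_norm) quasi_norm_ball_neighbourhood: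
  assumes "e > 0"
  shows "\<exists>U. openin (quasi_norm_topology N) U \<and> x \<in> U \<and> U \<subseteq> {y. N (y - x) < e}"
proof -
  obtain C where C: "\<And>x y. N (x + y) \<le> C * max (N x) (N y)"
    using quasi_triangle by blast
  define K where "K = max C 1"
  have nonneg: "N z \<ge> 0" for z
    using pos[of z] by (cases "z = 0") auto
  have K: "N (u + v) \<le> K * max (N u) (N v)" for u v
  proof (rule order_trans[OF C[of u v]])
    show "C * max (N u) (N v) \<le> K * max (N u) (N v)"
      using nonneg[of u] by (intro mult_right_mono) (auto simp: K_def le_max_iff_disj)
  qed
  have "K > 0"
    by (simp add: K_def)
  define U where "U = {z. \<exists>d>0. {y. N (y - z) < d} \<subseteq> {y. N (y - x) < e}}"
  have "\<exists>d>0. {y. N (y - z) < d} \<subseteq> U" if "z \<in> U" for z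
  proof -
    from that obtain d where "d > 0" and d: "\<And>y. N (y - z) < d \<Longrightarrow> N (y - x) < e"
      by (auto simp: U_def subset_eq)
    have "y \<in> U" if y: "N (y - z) < d / K" for y
    proof -
      have "N (w - x) < e" if w: "N (w - y) < d / K" for w
      proof -
        have "N (w - z) \<le> K * max (N (w - y)) (N (y - z))"
          using K[of "w - y" "y - z"] by simp
        also have "\<dots> < K * (d / K)"
          using y w \<open>K > 0\<close> by (intro mult_strict_left_mono) auto
        finally show ?thesis
          using d \<open>K > 0\<close> by auto
      qed
      moreover have "d / K > 0"
        using \<open>d > 0\<close> \<open>K > 0\<close> by simp
      ultimately show ?thesis
        by (auto simp: U_def)
    qed
    then show ?thesis
      using \<open>d > 0\<close> \<open>K > 0\<close> by (intro exI[of _ "d / K"]) auto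
  qed
  then have "openin (quasi_norm_topology N) U"
    by (simp add: openin_quasi_norm_topology)
  moreover have "x \<in> U"
    using assms by (auto simp: U_def)
  moreover have "U \<subseteq> {y. N (y - x) < e}"
    unfolding U_def by force
  ultimately show ?thesis
    by blast
qed

lemma quasi_norm_topology_norm:
  "quasi_norm_topology (norm :: 'a::real_normed_vector \<Rightarrow> real) = euclidean"
  unfolding topology_eq openin_quasi_norm_topology open_openin[symmetric] open_dist dist_norm
  by (simp add: subset_eq)

locale quasi_banach_lattice = quasi_norm N for N :: "'a::vector_lattice \<Rightarrow> real" +
  assumes complete: "completely_metrizable_space (quasi_norm_topology N)"
    and lattice_norm: "\<bar>x\<bar> \<le> \<bar>y\<bar> \<Longrightarrow> N x \<le> N y"


section \<open>The Banach lattice of real null sequences\<close>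

typedef c0 = "{x :: nat \<Rightarrow> real. x \<longlonglongrightarrow> 0}"
  morphisms c0_nth Abs_c0
  by (rule exI[of _ "\<lambda>_. 0"]) simp

setup_lifting type_definition_c0

lemma c0_eqI: "(\<And>n. c0_nth x n = c0_nth y n) \<Longrightarrow> x = y"
  by transfer auto

lemma c0_nth_tendsto: "c0_nth x \<longlonglongrightarrow> 0"
  using c0_nth by auto

lemma bdd_above_c0: "bdd_above (range (\<lambda>n. \<bar>c0_nth x n\<bar>))"
proof -
  have "Bseq (c0_nth x)"
    using c0_nth_tendsto convergentI convergent_imp_Bseq by blast
  then show ?thesis
    by (auto simp: Bseq_def bdd_above_def)
qed

instantiation c0 :: vector_lattice
begin

lift_definition zero_c0 :: c0 is "\<lambda>_. 0" by simp
lift_definition plus_c0 :: "c0 \<Rightarrow> c0 \<Rightarrow> c0" is "\<lambda>x y n. x n + y n"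
  using tendsto_add by fastforce
lift_definition minus_c0 :: "c0 \<Rightarrow> c0 \<Rightarrow> c0" is "\<lambda>x y n. x n - y n"
  using tendsto_diff by fastforce
lift_definition uminus_c0 :: "c0 \<Rightarrow> c0" is "\<lambda>x n. - x n"
  using tendsto_minus by fastforce
lift_definition scaleR_c0 :: "real \<Rightarrow> c0 \<Rightarrow> c0" is "\<lambda>a x n. a * x n"
  by (rule tendsto_mult_right_zero)
lift_definition less_eq_c0 :: "c0 \<Rightarrow> c0 \<Rightarrow> bool" is "\<lambda>x y. \<forall>n. x n \<le> y n" .
definition less_c0 :: "c0 \<Rightarrow> c0 \<Rightarrow> bool" where "less_c0 x y \<longleftrightarrow> x \<le> y \<and> \<not> y \<le> x"
lift_definition sup_c0 :: "c0 \<Rightarrow> c0 \<Rightarrow> c0" is "\<lambda>x y n. max (x n) (y n)"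
  using tendsto_max by fastforce
lift_definition inf_c0 :: "c0 \<Rightarrow> c0 \<Rightarrow> c0" is "\<lambda>x y n. min (x n) (y n)"
  using tendsto_min by fastforce
lift_definition abs_c0 :: "c0 \<Rightarrow> c0" is "\<lambda>x n. \<bar>x n\<bar>"
  by (rule tendsto_rabs_zero)

instance
proof
  fix x y z :: c0 and a b :: real
  show "x + y + z = x + (y + z)" by transfer (simp add: add.assoc)
  show "x + y = y + x" by transfer (simp add: add.commute)
  show "0 + x = x" by transfer simp
  show "- x + x = 0" by transfer simp
  show "x - y = x + - y" by transfer simp
  show "a *\<^sub>R (x + y) = a *\<^sub>R x + a *\<^sub>R y" by transfer (simp add: distrib_left)
  show "(a + b) *\<^sub>R x = a *\<^sub>R x + b *\<^sub>R x" by transfer (simp add: distrib_right)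
  show "a *\<^sub>R b *\<^sub>R x = (a * b) *\<^sub>R x" by transfer (simp add: mult.assoc)
  show "1 *\<^sub>R x = x" by transfer simp
  show "x < y \<longleftrightarrow> x \<le> y \<and> \<not> y \<le> x" by (rule less_c0_def)
  show "x \<le> x" by transfer simp
  show "x \<le> z" if "x \<le> y" "y \<le> z" using that by transfer (meson order_trans)
  show "x = y" if "x \<le> y" "y \<le> x" using that by transfer (auto intro: antisym)
  show "z + x \<le> z + y" if "x \<le> y" using that by transfer simp
  show "a *\<^sub>R x \<le> a *\<^sub>R y" if "x \<le> y" "0 \<le> a"
    using that by transfer (simp add: mult_left_mono)
  show "a *\<^sub>R x \<le> b *\<^sub>R x" if "a \<le> b" "0 \<le> x"
    using that by transfer (simp add: mult_right_mono)
  show "inf x y \<le> x" "inf x y \<le> y" by (transfer, simp)+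
  show "x \<le> inf y z" if "x \<le> y" "x \<le> z" using that by transfer simp
  show "x \<le> sup x y" "y \<le> sup x y" by (transfer, simp)+
  show "sup y z \<le> x" if "y \<le> x" "z \<le> x" using that by transfer simp
  show "\<bar>x\<bar> = sup x (- x)" by transfer (auto simp: max_def)
qed

end

instantiation c0 :: real_normed_vector
begin

definition norm_c0 :: "c0 \<Rightarrow> real" where "norm_c0 x = (SUP n. \<bar>c0_nth x n\<bar>)"
definition dist_c0 :: "c0 \<Rightarrow> c0 \<Rightarrow> real" where "dist_c0 x y = norm (x - y)"
definition sgn_c0 :: "c0 \<Rightarrow> c0" where "sgn_c0 x = x /\<^sub>R norm x"
definition uniformity_c0 :: "(c0 \<times> c0) filter"
  where "uniformity_c0 = (INF e\<in>{0 <..}. principal {(x, y). dist x y < e})"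
definition open_c0 :: "c0 set \<Rightarrow> bool"
  where "open_c0 S = (\<forall>x\<in>S. \<forall>\<^sub>F (x', y) in uniformity. x' = x \<longrightarrow> y \<in> S)"

lemma abs_c0_nth_le_norm: "\<bar>c0_nth x n\<bar> \<le> norm x"
  unfolding norm_c0_def by (rule cSUP_upper[OF _ bdd_above_c0]) simp

lemma norm_c0_le: "(\<And>n. \<bar>c0_nth x n\<bar> \<le> b) \<Longrightarrow> norm x \<le> b"
  unfolding norm_c0_def by (rule cSUP_least) auto

instance
proof
  fix x y :: c0 and a :: real and S :: "c0 set"
  show "dist x y = norm (x - y)" by (rule dist_c0_def)
  show "sgn x = x /\<^sub>R norm x" by (rule sgn_c0_def)
  show "uniformity = (INF e\<in>{0 <..}. principal {(x :: c0, y). dist x y < e})"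
    by (rule uniformity_c0_def)
  show "open S \<longleftrightarrow> (\<forall>x\<in>S. \<forall>\<^sub>F (x', y) in uniformity. x' = x \<longrightarrow> y \<in> S)"
    by (rule open_c0_def)
  have nonneg: "norm z \<ge> 0" for z :: c0
    using abs_c0_nth_le_norm[of z 0] by linarith
  have zero: "norm (0 :: c0) = 0"
    by (rule antisym[OF norm_c0_le nonneg]) (simp add: zero_c0.rep_eq)
  show "norm x = 0 \<longleftrightarrow> x = 0"
  proof
    assume "norm x = 0"
    then show "x = 0"
      using abs_c0_nth_le_norm[of x] by (intro c0_eqI) (simp add: zero_c0.rep_eq)
  qed (simp add: zero)
  show "norm (x + y) \<le> norm x + norm y"
  proof (rule norm_c0_le)
    fix n
    show "\<bar>c0_nth (x + y) n\<bar> \<le> norm x + norm y"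
      using abs_c0_nth_le_norm[of x n] abs_c0_nth_le_norm[of y n]
      by (simp add: plus_c0.rep_eq)
  qed
  have le: "norm (b *\<^sub>R z) \<le> \<bar>b\<bar> * norm z" for b and z :: c0
    by (rule norm_c0_le)
      (simp add: scaleR_c0.rep_eq abs_mult mult_left_mono abs_c0_nth_le_norm)
  show "norm (a *\<^sub>R x) = \<bar>a\<bar> * norm x"
  proof (cases "a = 0")
    case True
    then show ?thesis
      using zero by simp
  next
    case False
    have "norm x \<le> \<bar>inverse a\<bar> * norm (a *\<^sub>R x)"
      using le[of "inverse a" "a *\<^sub>R x"] False by simp
    then have "\<bar>a\<bar> * norm x \<le> norm (a *\<^sub>R x)"
      using False by (simp add: field_simps)
    then show ?thesis
      using le[of a x] by linarith
  qed
qed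

end

instance c0 :: banach
proof
  fix X :: "nat \<Rightarrow> c0"
  assume X: "Cauchy X"
  have close: "\<bar>c0_nth (X m) k - c0_nth (X n) k\<bar> \<le> dist (X m) (X n)" for m n k
    using abs_c0_nth_le_norm[of "X m - X n" k] by (simp add: minus_c0.rep_eq dist_norm)
  have "Cauchy (\<lambda>n. c0_nth (X n) k)" for k
    using X close unfolding Cauchy_def dist_real_def by (meson le_less_trans)
  then have "\<exists>l. (\<lambda>n. c0_nth (X n) k) \<longlonglongrightarrow> l" for k
    by (simp add: Cauchy_convergent_iff convergent_def)
  then obtain L where L: "\<And>k. (\<lambda>n. c0_nth (X n) k) \<longlonglongrightarrow> L k"
    using choice[of "\<lambda>k l. (\<lambda>n. c0_nth (X n) k) \<longlonglongrightarrow> l"] by blast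
  have unif: "\<exists>M. \<forall>n\<ge>M. \<forall>k. \<bar>c0_nth (X n) k - L k\<bar> \<le> e" if e: "e > 0" for e
  proof -
    obtain M where M: "\<And>m n. m \<ge> M \<Longrightarrow> n \<ge> M \<Longrightarrow> dist (X m) (X n) < e"
      using metric_CauchyD[OF X e] by blast
    have "\<bar>c0_nth (X n) k - L k\<bar> \<le> e" if "n \<ge> M" for n k
    proof (rule LIMSEQ_le_const2)
      show "(\<lambda>m. \<bar>c0_nth (X n) k - c0_nth (X m) k\<bar>) \<longlonglongrightarrow> \<bar>c0_nth (X n) k - L k\<bar>"
        by (intro tendsto_intros L)
      show "\<exists>N. \<forall>m\<ge>N. \<bar>c0_nth (X n) k - c0_nth (X m) k\<bar> \<le> e"
        using M[OF that] close[of n k] by (meson le_less_trans less_imp_le)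
    qed
    then show ?thesis
      by blast
  qed
  have "L \<longlonglongrightarrow> 0"
  proof (rule LIMSEQ_I)
    fix r :: real
    assume "r > 0"
    then obtain M where M: "\<And>k. \<bar>c0_nth (X M) k - L k\<bar> \<le> r / 2"
      using unif[of "r / 2"] by auto
    obtain K where K: "\<And>k. k \<ge> K \<Longrightarrow> \<bar>c0_nth (X M) k\<bar> < r / 2"
      using LIMSEQ_D[OF c0_nth_tendsto, of "r / 2" "X M"] \<open>r > 0\<close> by auto
    have "norm (L k - 0) < r" if "k \<ge> K" for k
      using M[of k] K[OF that] unfolding real_norm_def diff_zero by linarith
    then show "\<exists>no. \<forall>n\<ge>no. norm (L n - 0) < r"
      by blast
  qed
  then have nth: "c0_nth (Abs_c0 L) = L"
    by (simp add: Abs_c0_inverse)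
  have "X \<longlonglongrightarrow> Abs_c0 L"
  proof (rule LIMSEQ_I)
    fix r :: real
    assume "r > 0"
    then obtain M where M: "\<And>n k. n \<ge> M \<Longrightarrow> \<bar>c0_nth (X n) k - L k\<bar> \<le> r / 2"
      using unif[of "r / 2"] by auto
    have "norm (X n - Abs_c0 L) < r" if "n \<ge> M" for n
    proof -
      have "norm (X n - Abs_c0 L) \<le> r / 2"
        using M[OF that] by (intro norm_c0_le) (simp add: minus_c0.rep_eq nth)
      then show ?thesis
        using \<open>r > 0\<close> by linarith
    qed
    then show "\<exists>no. \<forall>n\<ge>no. norm (X n - Abs_c0 L) < r"
      by blast
  qed
  then show "convergent X"
    by (auto simp: convergent_def)
qed

lemma quasi_banach_lattice_c0: "quasi_banach_lattice (norm :: c0 \<Rightarrow> real)"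
proof
  fix x y :: c0 and a :: real
  show "x \<noteq> 0 \<Longrightarrow> norm x > 0" by simp
  show "norm (a *\<^sub>R x) = \<bar>a\<bar> * norm x" by simp
  have "norm (u + v) \<le> 2 * max (norm u) (norm v)" for u v :: c0
    using norm_triangle_ineq[of u v] by linarith
  then show "\<exists>C. \<forall>u v :: c0. norm (u + v) \<le> C * max (norm u) (norm v)"
    by blast
  show "completely_metrizable_space (quasi_norm_topology (norm :: c0 \<Rightarrow> real))"
    by (simp add: quasi_norm_topology_norm completely_metrizable_space_euclidean)
  show "norm x \<le> norm y" if "\<bar>x\<bar> \<le> \<bar>y\<bar>"
  proof (rule norm_c0_le)
    fix n
    have "\<bar>c0_nth x n\<bar> \<le> \<bar>c0_nth y n\<bar>"
      using that by (simp add: less_eq_c0.rep_eq abs_c0.rep_eq)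
    then show "\<bar>c0_nth x n\<bar> \<le> norm y"
      using abs_c0_nth_le_norm[of y n] by linarith
  qed
qed

end

theory Submission
  imports Defs
begin

text \<open>
  Call a disjoint sequence of positive elements, with norms bounded away from zero and with
  bounded partial sums, a \<open>c0\<close> basis. Such a sequence spans a closed linear copy of \<open>c0\<close>, and every
  disjoint order bounded sequence that is not null has a \<open>c0\<close> basis among its subsequences.
  It therefore suffices that an order isomorphism \<open>T\<close> of \<open>E\<close> onto a closed sublattice of \<open>F\<close>
  transports \<open>c0\<close> bases from \<open>E\<close> to \<open>F\<close>; apply this first to the isomorphism of \<open>c0\<close>
  onto \<open>G\<close> and then to that of \<open>E\<close> onto \<open>F\<close>.

  Suppose \<open>F\<close> has no \<open>c0\<close> basis and let \<open>e\<close> be one of \<open>E\<close>. Series \<open>\<Sum>k. t k *\<^sub>R e k\<close> with null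
  coefficients converge in \<open>E\<close>, so \<open>T\<close> is uniformly small on all finite sums of late \<open>\<delta> *\<^sub>R e k\<close>
  when \<open>\<delta>\<close> is small; as \<open>F\<close> has no \<open>c0\<close> basis, \<open>T (\<delta> *\<^sub>R e k)\<close> is null, and the same holds for
  \<open>T (x + \<delta> *\<^sub>R e k) - T x\<close> for every base point \<open>x\<close>.
  On the other hand, the set of \<open>r\<close> for which \<open>T (r *\<^sub>R e k)\<close> has a null subsequence is bounded:
  otherwise a convergent series \<open>\<Sum>k. T (k *\<^sub>R e (i k))\<close> would yield a common upper bound in \<open>E\<close> of
  all \<open>k *\<^sub>R e (i k)\<close>. Near its supremum \<open>L\<close>, choose \<open>a k\<close> tending to \<open>L\<close> such that
  \<open>T x = (\<Sum>k. T (a k *\<^sub>R e (i k)))\<close> converges; the increments at this \<open>x\<close> show that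
  \<open>L + \<delta> / 2\<close> also belongs to the set, a contradiction.
\<close>

section \<open>Disjoint elements of a vector lattice\<close>

text \<open>The left side lies below both \<open>inf a c + b\<close> and \<open>inf a c + c\<close>;
  the infimum of these two bounds is the right side.\<close>

lemma inf_add_le:
  fixes a b c :: "'a::vector_lattice"
  assumes "0 \<le> a" "0 \<le> b" "0 \<le> c"
  shows "inf (a + b) c \<le> inf a c + inf b c"
proof -
  have "inf (a + b) c \<le> inf a c + b"
    unfolding add_inf_distrib_right using assms(2)
    by (meson inf.boundedI inf.cobounded1 inf.cobounded2 add_increasing2 order_trans order_refl)
  moreover have "inf (a + b) c \<le> inf a c + c"
    unfolding add_inf_distrib_right using assms
    by (meson inf.boundedI inf.cobounded1 inf.cobounded2 add_increasing2 add_increasing order_trans order_refl)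
  ultimately show ?thesis
    by (simp add: add_inf_distrib_left)
qed

lemma inf_sum_eq_0:
  fixes x :: "'i \<Rightarrow> 'a::vector_lattice"
  assumes "\<And>i. i \<in> A \<Longrightarrow> 0 \<le> x i" "\<And>i. i \<in> A \<Longrightarrow> inf (x i) c = 0" "0 \<le> c"
  shows "inf (sum x A) c = 0"
proof (cases "finite A")
  case True
  then show ?thesis
    using assms
  proof (induction A)
    case (insert i A)
    have "inf (x i + sum x A) c \<le> inf (x i) c + inf (sum x A) c"
      using insert by (intro inf_add_le sum_nonneg) auto
    also have "\<dots> = 0"
      using insert by simp
    finally have "inf (x i + sum x A) c \<le> 0" .
    moreover have "0 \<le> inf (x i + sum x A) c"
      using insert by (intro inf.boundedI add_nonneg_nonneg sum_nonneg) auto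
    ultimately show ?case
      using insert by simp
  qed (simp add: inf_absorb1)
qed (simp add: assms inf_absorb1)

lemma inf_scaleR_eq_0:
  fixes x y :: "'a::vector_lattice"
  assumes "0 \<le> x" "0 \<le> y" "inf x y = 0" "0 \<le> a" "0 \<le> b"
  shows "inf (a *\<^sub>R x) (b *\<^sub>R y) = 0"
proof -
  \<comment> \<open>One factor dominating both coefficients; the added 1 keeps it positive, so that
    the infimum can be divided by it.\<close>
  define m where "m = max a b + 1"
  have m: "m > 0" "a \<le> m" "b \<le> m"
    using assms by (auto simp: m_def)
  let ?w = "inf (a *\<^sub>R x) (b *\<^sub>R y)"
  have "?w \<le> m *\<^sub>R x" "?w \<le> m *\<^sub>R y"
    using m assms by (meson inf.cobounded1 inf.cobounded2 order_trans scaleR_right_mono)+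
  then have "(1 / m) *\<^sub>R ?w \<le> x" "(1 / m) *\<^sub>R ?w \<le> y"
    using m by (auto simp: pos_divideR_le_eq divide_inverse pos_le_divideR_eq)
  then have "(1 / m) *\<^sub>R ?w \<le> 0"
    using assms(3) by (metis inf.boundedI)
  then have "?w \<le> 0"
    using m by (auto simp: scaleR_le_0_iff)
  moreover have "0 \<le> ?w"
    using assms by (simp add: scaleR_nonneg_nonneg)
  ultimately show ?thesis
    by simp
qed

lemma disjoint_add_eq_sup:
  fixes x y :: "'a::vector_lattice"
  shows "inf x y = 0 \<Longrightarrow> x + y = sup x y"
  using add_eq_inf_sup[of x y] by simp

lemma disjoint_diff_sup_0:
  fixes x y :: "'a::vector_lattice"
  assumes "inf x y = 0"
  shows "sup (x - y) 0 = x"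
proof -
  have "sup (x - y) 0 = sup x y - y"
    using add_sup_distrib_right[of x y "- y"] by simp
  then show ?thesis
    using disjoint_add_eq_sup[OF assms] by (metis add_diff_cancel_right')
qed

text \<open>This and the next identity express \<open>sup\<close> and \<open>inf\<close> through
  addition and the positive part, so that a linear map commuting with positive parts preserves both
  lattice operations.\<close>

lemma sup_eq_add_sup_diff:
  fixes x y :: "'a::vector_lattice"
  shows "sup x y = y + sup (x - y) 0"
  by (simp add: add_sup_distrib_left)

lemma inf_eq_diff_sup:
  fixes x y :: "'a::vector_lattice"
  shows "inf x y = x + y - sup x y"
  using add_eq_inf_sup[of x y] by (metis add_diff_cancel_left')

lemma sup_0_diff_le:
  fixes x y :: "'a::vector_lattice"
  shows "sup x 0 - sup y 0 \<le> \<bar>x - y\<bar>"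
proof -
  have "x \<le> \<bar>x - y\<bar> + sup y 0"
    by (metis abs_ge_self add_mono diff_add_cancel sup_ge1)
  moreover have "0 \<le> \<bar>x - y\<bar> + sup y 0"
    by simp
  ultimately show ?thesis
    unfolding diff_le_eq by (rule sup_least)
qed

text \<open>The two one-sided estimates combine: taking positive parts is nonexpansive, hence
  continuous for every lattice quasi-norm.\<close>

lemma abs_sup_0_diff_le:
  fixes x y :: "'a::vector_lattice"
  shows "\<bar>sup x 0 - sup y 0\<bar> \<le> \<bar>x - y\<bar>"
  using sup_0_diff_le[of x y] sup_0_diff_le[of y x]
  by (metis abs_leI abs_minus_commute minus_diff_eq)

section \<open>Disjoint sequences and their finite sums\<close>

definition disjoint_seq :: "(nat \<Rightarrow> 'a::vector_lattice) \<Rightarrow> bool"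
  where "disjoint_seq x \<longleftrightarrow> (\<forall>i. 0 \<le> x i) \<and> (\<forall>i j. i \<noteq> j \<longrightarrow> inf (x i) (x j) = 0)"

lemma disjoint_seq_nonneg: "disjoint_seq x \<Longrightarrow> 0 \<le> x i"
  by (simp add: disjoint_seq_def)

lemma disjoint_seq_inf: "disjoint_seq x \<Longrightarrow> i \<noteq> j \<Longrightarrow> inf (x i) (x j) = 0"
  by (simp add: disjoint_seq_def)

lemma disjoint_seq_sum_nonneg: "disjoint_seq x \<Longrightarrow> 0 \<le> sum x A"
  by (simp add: disjoint_seq_nonneg sum_nonneg)

lemma disjoint_seq_sum_mono: "disjoint_seq x \<Longrightarrow> finite B \<Longrightarrow> A \<subseteq> B \<Longrightarrow> sum x A \<le> sum x B"
  by (simp add: disjoint_seq_nonneg sum_mono2)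

lemma disjoint_seq_subseq:
  "disjoint_seq x \<Longrightarrow> inj r \<Longrightarrow> disjoint_seq (\<lambda>i. x (r i))"
  by (simp add: disjoint_seq_def inj_eq)

lemma disjoint_seq_scaleR:
  assumes "disjoint_seq x" "\<And>i. 0 \<le> a i"
  shows "disjoint_seq (\<lambda>i. a i *\<^sub>R x i)"
  using assms by (simp add: disjoint_seq_def scaleR_nonneg_nonneg inf_scaleR_eq_0)

lemma disjoint_seq_inf_sum:
  assumes "disjoint_seq x" "A \<inter> B = {}"
  shows "inf (sum x A) (sum x B) = 0"
proof (rule inf_sum_eq_0)
  fix i
  assume i: "i \<in> A"
  have "inf (sum x B) (x i) = 0"
    using assms i by (intro inf_sum_eq_0) (auto simp: disjoint_seq_nonneg intro!: disjoint_seq_inf)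
  then show "inf (x i) (sum x B) = 0"
    by (simp add: inf_commute)
qed (use assms in \<open>auto simp: disjoint_seq_nonneg sum_nonneg\<close>)

text \<open>Sums of disjoint positive elements are suprema, so a common upper bound of the terms
  also bounds the sum.\<close>

lemma disjoint_seq_sum_le:
  assumes "disjoint_seq x" "finite A" "\<And>i. i \<in> A \<Longrightarrow> x i \<le> u" "0 \<le> u"
  shows "sum x A \<le> u"
  using assms(2,3)
proof (induction A)
  case (insert i A)
  have "inf (x i) (sum x A) = 0"
    using disjoint_seq_inf_sum[OF assms(1), of "{i}" A] insert by simp
  then show ?case
    using insert by (simp add: disjoint_add_eq_sup)
qed (simp add: assms)

lemma sum_blocks:
  fixes x :: "nat \<Rightarrow> 'a::ab_group_add"
  assumes "mono r"
  shows "(\<Sum>k<n. \<Sum>i\<in>{r k..<r (Suc k)}. x i) = (\<Sum>i\<in>{r 0..<r n}. x i)"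
proof (induction n)
  case (Suc n)
  have "r 0 \<le> r n" "r n \<le> r (Suc n)"
    using assms by (simp_all add: monoD)
  then show ?case
    by (simp add: Suc sum.atLeastLessThan_concat)
qed simp

lemma disjoint_seq_blocks:
  assumes "disjoint_seq x" "mono r"
  shows "disjoint_seq (\<lambda>k. \<Sum>i\<in>{r k..<r (Suc k)}. x i)"
proof -
  have "{r i..<r (Suc i)} \<inter> {r j..<r (Suc j)} = {}" if "i < j" for i j
    using monoD[OF assms(2), of "Suc i" j] that by auto
  then have "{r i..<r (Suc i)} \<inter> {r j..<r (Suc j)} = {}" if "i \<noteq> j" for i j
    using that by (metis inf_commute linorder_neqE_nat)
  then show ?thesis
    using disjoint_seq_inf_sum[OF assms(1)] disjoint_seq_sum_nonneg[OF assms(1)]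
    by (simp add: disjoint_seq_def)
qed

section \<open>Convergence in quasi-Banach lattices\<close>

lemma tendsto_0_le_real:
  fixes f g :: "'b \<Rightarrow> real"
  assumes "\<And>n. 0 \<le> f n" "\<And>n. f n \<le> g n" "(g \<longlongrightarrow> 0) F"
  shows "(f \<longlongrightarrow> 0) F"
  using assms by (intro Lim_null_comparison[OF _ assms(3)]) simp

context quasi_norm
begin

lemma nonneg [simp]: "0 \<le> N x"
  using pos[of x] by (cases "x = 0") auto

lemma eq_0_iff: "N x = 0 \<longleftrightarrow> x = 0"
  using pos[of x] by force

lemma minus [simp]: "N (- x) = N x"
  using scale[of "-1" x] by simp

lemma diff_commute: "N (x - y) = N (y - x)"
  using minus[of "x - y"] by simp

lemma quasi_triangle_ge_1: obtains C where "1 \<le> C" "\<And>x y. N (x + y) \<le> C * max (N x) (N y)"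
proof -
  obtain C where C: "\<And>x y. N (x + y) \<le> C * max (N x) (N y)"
    using quasi_triangle by blast
  have "N (x + y) \<le> max C 1 * max (N x) (N y)" for x y
    by (rule order_trans[OF C[of x y]], intro mult_right_mono) (auto simp: le_max_iff_disj)
  then show ?thesis
    using that[of "max C 1"] by auto
qed

lemma tendsto_add_0:
  assumes "((\<lambda>n. N (x n)) \<longlongrightarrow> 0) F" "((\<lambda>n. N (y n)) \<longlongrightarrow> 0) F"
  shows "((\<lambda>n. N (x n + y n)) \<longlongrightarrow> 0) F"
proof -
  obtain C where C: "1 \<le> C" "\<And>x y. N (x + y) \<le> C * max (N x) (N y)"
    using quasi_triangle_ge_1 by blast
  have "((\<lambda>n. C * max (N (x n)) (N (y n))) \<longlongrightarrow> C * max 0 0) F"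
    by (intro tendsto_intros assms)
  then show ?thesis
    using tendsto_0_le_real[of "\<lambda>n. N (x n + y n)", OF nonneg C(2)] by simp
qed

lemma tendsto_scaleR_0:
  "((\<lambda>n. N (x n)) \<longlongrightarrow> 0) F \<Longrightarrow> ((\<lambda>n. N (a *\<^sub>R x n)) \<longlongrightarrow> 0) F"
  using tendsto_mult_right_zero by (auto simp: scale)

lemma limit_unique:
  assumes "((\<lambda>n. N (x n - l)) \<longlongrightarrow> 0) F" "((\<lambda>n. N (x n - l')) \<longlongrightarrow> 0) F" "F \<noteq> bot"
  shows "l = l'"
proof -
  have "((\<lambda>n. N ((l - x n) + (x n - l'))) \<longlongrightarrow> 0) F"
    using assms by (intro tendsto_add_0) (simp_all add: diff_commute[of l])
  then have "N (l - l') = 0"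
    using assms(3) tendsto_const_iff[of F "N (l - l')" 0] by simp
  then show ?thesis
    by (simp add: eq_0_iff)
qed

section \<open>Completeness and closed sets in terms of sequences\<close>

definition N_Cauchy :: "(nat \<Rightarrow> 'a) \<Rightarrow> bool"
  where "N_Cauchy x \<longleftrightarrow> (\<forall>e>0. \<exists>n. \<forall>i\<ge>n. \<forall>j\<ge>n. N (x i - x j) < e)"

text \<open>
  Klee's theorem for metrizability: complete metrizability of the topology alone makes the
  uniformity complete. For a Cauchy sequence \<open>x\<close> pass to a subsequence and put
  \<open>w\<^sub>k\<^sub>+\<^sub>1 = x m\<^sub>k\<^sub>+\<^sub>1 - w\<^sub>k\<close>. Then \<open>w\<^sub>k\<^sub>+\<^sub>2 - w\<^sub>k\<close> is an increment of \<open>x\<close>, which may be taken so small,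
  depending on \<open>w\<^sub>k\<close>, that the even and the odd terms of \<open>w\<close> are Cauchy for the given complete
  metric. Their limits add up to the limit of \<open>x\<close>.
\<close>

lemma N_Cauchy_convergent:
  assumes compl: "completely_metrizable_space (quasi_norm_topology N)" and x: "N_Cauchy x"
  obtains l where "(\<lambda>n. N (x n - l)) \<longlonglongrightarrow> 0"
proof -
  obtain M d where "Metric_space M d" and mc: "Metric_space.mcomplete M d"
    and top: "quasi_norm_topology N = Metric_space.mtopology M d"
    using compl unfolding completely_metrizable_space_def by blast
  moreover from this have "M = UNIV"
    by (metis Metric_space.topspace_mtopology topspace_quasi_norm_topology)
  ultimately have "Metric_space UNIV d" and mc: "Metric_space.mcomplete UNIV d"
    and top: "quasi_norm_topology N = Metric_space.mtopology UNIV d"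
    by auto
  interpret Metric_space UNIV d by fact
  have small: "\<exists>r>0. \<forall>y. N (y - a) < r \<longrightarrow> d a y < e" if "e > 0" for a e
  proof -
    have "openin (quasi_norm_topology N) (mball a e)"
      by (simp add: top)
    moreover have "a \<in> mball a e"
      using that by simp
    ultimately obtain r where "r > 0" "{y. N (y - a) < r} \<subseteq> mball a e"
      unfolding openin_quasi_norm_topology by blast
    then show ?thesis
      by (intro exI[of _ r]) (auto simp: subset_iff)
  qed
  have lim: "(\<lambda>n. N (w n - l)) \<longlonglongrightarrow> 0" if "limitin mtopology w l sequentially" for w l
  proof (rule LIMSEQ_I)
    fix e :: real
    assume "e > 0"
    obtain U where "openin mtopology U" "l \<in> U" "U \<subseteq> {y. N (y - l) < e}"
      using quasi_norm_ball_neighbourhood[OF \<open>e > 0\<close>] top by metis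
    then have "\<forall>\<^sub>F n in sequentially. N (w n - l) < e"
      using that unfolding limitin_def by (auto elim!: eventually_mono)
    then show "\<exists>n. \<forall>k\<ge>n. norm (N (w k - l) - 0) < e"
      by (simp add: eventually_sequentially)
  qed
  \<comment> \<open>A state pairs an index \<open>m k\<close> with a value \<open>w k\<close>. The
    last clause speaks of the whole tail of \<open>x\<close>, because the increment leading from
    \<open>w k\<close> to \<open>w (Suc (Suc k))\<close> involves an index that is chosen only one
    step later.\<close>
  define P where "P k s s' \<longleftrightarrow> fst s' > fst s \<and> snd s' = x (fst s') - snd s
      \<and> (\<forall>i\<ge>fst s'. \<forall>j\<ge>fst s'. d (snd s) (snd s + (x i - x j)) < (1/2)^k)"
    for k and s s' :: "nat \<times> 'a"
  have "\<exists>s'. P k s s'" for k s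
  proof -
    obtain r where r: "r > 0" "\<And>y. N (y - snd s) < r \<Longrightarrow> d (snd s) y < (1/2)^k"
      using small[of "(1/2)^k" "snd s"] by auto
    obtain n where n: "\<And>i j. i \<ge> n \<Longrightarrow> j \<ge> n \<Longrightarrow> N (x i - x j) < r"
      using x r(1) unfolding N_Cauchy_def by meson
    have "P k s (max n (Suc (fst s)), x (max n (Suc (fst s))) - snd s)"
      using n r(2) by (auto simp: P_def)
    then show ?thesis ..
  qed
  then obtain s where s: "\<And>k. P k (s k) (s (Suc k))"
    using dependent_nat_choice[of "\<lambda>_ _. True" P] by auto
  define m w where "m k = fst (s k)" and "w k = snd (s k)" for k
  have m: "strict_mono m"
    using s by (simp add: strict_mono_Suc_iff P_def m_def)
  have w: "w (Suc k) = x (m (Suc k)) - w k" for k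
    using s[of k] by (simp add: P_def m_def w_def)
  have "d (w k) (w (Suc (Suc k))) < (1/2)^k" for k
  proof -
    have "m (Suc k) \<le> m (Suc (Suc k))"
      using m by (simp add: strict_mono_less_eq)
    then have "d (w k) (w k + (x (m (Suc (Suc k))) - x (m (Suc k)))) < (1/2)^k"
      using s[of k] by (simp add: P_def m_def w_def)
    moreover have "w k + (x (m (Suc (Suc k))) - x (m (Suc k))) = w (Suc (Suc k))"
      by (simp add: w)
    ultimately show ?thesis
      by simp
  qed
  then have step: "d (w k) (w (k + 2)) < (1/2)^k" for k
    by simp
  have conv: "\<exists>l. limitin mtopology (\<lambda>n. w (2 * n + q)) l sequentially" for q
  proof -
    define v where "v n = w (2 * n + q)" for n
    have v: "d (v n) (v (Suc n)) \<le> (1/2)^n" for n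
    proof -
      have "d (v n) (v (Suc n)) < (1/2)^(2 * n + q)"
        using step[of "2 * n + q"] by (simp add: v_def)
      also have "\<dots> \<le> (1/2)^n"
        by (intro power_decreasing) auto
      finally show ?thesis
        by simp
    qed
    \<comment> \<open>The subtracted term closes the telescoping induction, since
      \<open>(1/2)^j\<close> equals \<open>2 * (1/2)^j - 2 * (1/2)^(j + 1)\<close>.\<close>
    have tail: "d (v n) (v (n + k)) \<le> 2 * (1/2)^n - 2 * (1/2)^(n + k)" for n k
    proof (induction k)
      case (Suc k)
      have "d (v n) (v (n + Suc k)) \<le> d (v n) (v (n + k)) + d (v (n + k)) (v (Suc (n + k)))"
        using triangle[of "v n" "v (n + k)" "v (n + Suc k)"] by simp
      then show ?case
        using Suc v[of "n + k"] by simp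
    qed simp
    have tail': "d (v n) (v j) \<le> 2 * (1/2)^n" if "n \<le> j" for n j
    proof -
      have "d (v n) (v (n + (j - n))) \<le> 2 * (1/2)^n - 2 * (1/2)^(n + (j - n))"
        by (rule tail)
      moreover have "0 \<le> 2 * (1/2::real)^(n + (j - n))"
        by simp
      ultimately show ?thesis
        using that by (simp del: zero_le_power)
    qed
    have "MCauchy v"
      unfolding MCauchy_def
    proof (intro conjI allI impI)
      fix e :: real
      assume "e > 0"
      then obtain n where n: "(1/2)^n < e / 4"
        using real_arch_pow_inv[of "e / 4" "1/2"] by auto
      have "d (v i) (v j) < e" if "n \<le> i" "n \<le> j" for i j
      proof -
        have "d (v i) (v j) \<le> d (v i) (v n) + d (v n) (v j)"
          by (intro triangle) auto
        then show ?thesis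
          using tail'[OF that(1)] tail'[OF that(2)] n by (simp add: commute)
      qed
      then show "\<exists>n. \<forall>i j. n \<le> i \<longrightarrow> n \<le> j \<longrightarrow> d (v i) (v j) < e"
        by blast
    qed simp
    then show ?thesis
      using mc unfolding mcomplete_def v_def by blast
  qed
  obtain a b where a: "(\<lambda>n. N (w (2 * n) - a)) \<longlonglongrightarrow> 0" and b: "(\<lambda>n. N (w (2 * n + 1) - b)) \<longlonglongrightarrow> 0"
    using lim conv[of 0] conv[of 1] by fastforce
  have sub: "(\<lambda>n. N (x (m (2 * n + 1)) - (a + b))) \<longlonglongrightarrow> 0"
  proof -
    have "x (m (2 * n + 1)) - (a + b) = (w (2 * n) - a) + (w (2 * n + 1) - b)" for n
      using w[of "2 * n"] by simp
    then show ?thesis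
      using tendsto_add_0[OF a b] by presburger
  qed
  have cau: "(\<lambda>n. N (x n - x (m (2 * n + 1)))) \<longlonglongrightarrow> 0"
  proof (rule LIMSEQ_I)
    fix e :: real
    assume "e > 0"
    then obtain n where n: "\<And>i j. i \<ge> n \<Longrightarrow> j \<ge> n \<Longrightarrow> N (x i - x j) < e"
      using x unfolding N_Cauchy_def by meson
    have "m (2 * k + 1) \<ge> k" for k
      using strict_mono_imp_increasing[OF m, of "2 * k + 1"] by simp
    then have "\<forall>k\<ge>n. N (x k - x (m (2 * k + 1))) < e"
      using n by (meson order_trans)
    then show "\<exists>n. \<forall>k\<ge>n. norm (N (x k - x (m (2 * k + 1))) - 0) < e"
      by auto
  qed
  have "(\<lambda>n. N (x n - (a + b))) \<longlonglongrightarrow> 0"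
    using tendsto_add_0[OF cau sub] by (simp add: algebra_simps)
  then show ?thesis
    by (rule that)
qed

lemma closedin_limit:
  assumes "closedin (quasi_norm_topology N) G" "\<And>n. x n \<in> G" "(\<lambda>n. N (x n - l)) \<longlonglongrightarrow> 0"
  shows "l \<in> G"
proof (rule ccontr)
  assume "l \<notin> G"
  moreover have "openin (quasi_norm_topology N) (- G)"
    using assms(1) by (simp add: closedin_def Compl_eq_Diff_UNIV)
  ultimately obtain e where e: "e > 0" "{y. N (y - l) < e} \<subseteq> - G"
    unfolding openin_quasi_norm_topology by blast
  obtain n where "N (x n - l) < e"
    using LIMSEQ_D[OF assms(3) e(1)] by auto
  then show False
    using e(2) assms(2) by blast
qed

end

section \<open>Order and limits\<close>

context quasi_banach_lattice
begin

lemma mono: "0 \<le> x \<Longrightarrow> x \<le> y \<Longrightarrow> N x \<le> N y"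
  by (rule lattice_norm) simp

lemma abs [simp]: "N \<bar>x\<bar> = N x"
  by (rule antisym; rule lattice_norm) simp_all

lemma tendsto_le_0:
  assumes "((\<lambda>n. N (y n)) \<longlongrightarrow> 0) F" "\<And>n. 0 \<le> x n" "\<And>n. x n \<le> y n"
  shows "((\<lambda>n. N (x n)) \<longlongrightarrow> 0) F"
  by (rule tendsto_0_le_real[OF nonneg mono[OF assms(2,3)] assms(1)])

lemma tendsto_sup_0:
  assumes "((\<lambda>n. N (x n - l)) \<longlongrightarrow> 0) F"
  shows "((\<lambda>n. N (sup (x n) 0 - sup l 0)) \<longlongrightarrow> 0) F"
  by (rule tendsto_0_le_real[OF nonneg lattice_norm[OF abs_sup_0_diff_le] assms])

text \<open>The excess \<open>sup (x n) l - l\<close> is dominated by all later excesses, and these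
  by \<open>\<bar>x (k + n) - l\<bar>\<close>, which is null; so this constant excess is 0.\<close>

lemma incseq_le_limit:
  assumes "incseq x" "(\<lambda>n. N (x n - l)) \<longlonglongrightarrow> 0"
  shows "x n \<le> l"
proof -
  have "(\<lambda>k. N (sup (x (k + n)) l - l)) \<longlonglongrightarrow> 0"
  proof (rule tendsto_0_le_real[OF nonneg _ LIMSEQ_ignore_initial_segment[OF assms(2)]])
    fix k
    have "sup (x (k + n)) l \<le> \<bar>x (k + n) - l\<bar> + l"
      by (metis abs_ge_self abs_ge_zero diff_le_eq le_add_same_cancel2 sup_least)
    then have "\<bar>sup (x (k + n)) l - l\<bar> \<le> \<bar>x (k + n) - l\<bar>"
      by (metis abs_of_nonneg diff_ge_0_iff_ge diff_le_eq sup_ge2)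
    then show "N (sup (x (k + n)) l - l) \<le> N (x (k + n) - l)"
      by (rule lattice_norm)
  qed
  then have "(\<lambda>k. N (sup (x n) l - l)) \<longlonglongrightarrow> 0"
  proof (rule tendsto_le_0)
    fix k
    have "x n \<le> x (k + n)"
      using assms(1) by (simp add: incseqD)
    then show "sup (x n) l - l \<le> sup (x (k + n)) l - l"
      by (simp add: le_supI1)
  qed simp
  then have "sup (x n) l - l = 0"
    by (simp add: LIMSEQ_const_iff eq_0_iff)
  then show ?thesis
    by (simp add: sup.absorb_iff2)
qed

end

section \<open>Subsequences and convergent series\<close>

lemma frequently_subseq:
  fixes P :: "nat \<Rightarrow> nat \<Rightarrow> bool"
  assumes "\<And>k n. \<exists>i\<ge>n. P k i"
  shows "\<exists>r. strict_mono r \<and> (\<forall>k. P k (r k))"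
proof -
  have "\<exists>j. P (Suc k) j \<and> i < j" for i k
    using assms[of "Suc i" "Suc k"] by auto
  moreover have "\<exists>i. P 0 i"
    using assms by blast
  ultimately obtain r where "\<And>k. P k (r k)" "\<And>k. r k < r (Suc k)"
    using dependent_nat_choice[of P "\<lambda>_ i j. i < j"] by metis
  then show ?thesis
    by (auto simp: strict_mono_Suc_iff)
qed

context quasi_banach_lattice
begin

lemma series_convergent:
  fixes x :: "nat \<Rightarrow> 'a"
  assumes "\<And>e. e > 0 \<Longrightarrow> \<exists>m0. \<forall>m\<ge>m0. \<forall>n. N (\<Sum>k\<in>{m..<n}. x k) < e"
  obtains l where "(\<lambda>n. N ((\<Sum>k<n. x k) - l)) \<longlonglongrightarrow> 0"
proof -
  have diff: "N ((\<Sum>k<j. x k) - (\<Sum>k<i. x k)) = N (\<Sum>k\<in>{i..<j}. x k)" if "i \<le> j" for i j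
    using that sum_diff_nat_ivl[of 0 i j x] by (simp add: atLeast0LessThan)
  have "N_Cauchy (\<lambda>n. \<Sum>k<n. x k)"
    unfolding N_Cauchy_def
  proof (intro allI impI)
    fix e :: real
    assume "e > 0"
    then obtain m0 where m0: "\<And>m n. m \<ge> m0 \<Longrightarrow> N (\<Sum>k\<in>{m..<n}. x k) < e"
      using assms by blast
    have "N ((\<Sum>k<i. x k) - (\<Sum>k<j. x k)) < e" if "i \<ge> m0" "j \<ge> m0" for i j
    proof (cases "i \<le> j")
      case True
      then show ?thesis
        using diff[OF True] m0[OF that(1)] by (simp add: diff_commute)
    next
      case False
      then show ?thesis
        using diff[of j i] m0[OF that(2)] by simp
    qed
    then show "\<exists>n. \<forall>i\<ge>n. \<forall>j\<ge>n. N ((\<Sum>k<i. x k) - (\<Sum>k<j. x k)) < e"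
      by blast
  qed
  then show ?thesis
    using N_Cauchy_convergent[OF complete] that by blast
qed

lemma series_term_le_limit:
  fixes x :: "nat \<Rightarrow> 'a"
  assumes "\<And>k. 0 \<le> x k" "(\<lambda>n. N ((\<Sum>k<n. x k) - l)) \<longlonglongrightarrow> 0"
  shows "(\<Sum>k<n. x k) \<le> l" and "x k \<le> l"
proof -
  have le: "(\<Sum>k<n. x k) \<le> l" for n
    using assms by (intro incseq_le_limit) (auto simp: incseq_def intro!: sum_mono2)
  then show "(\<Sum>k<n. x k) \<le> l" .
  have "x k \<le> (\<Sum>i<Suc k. x i)"
    using assms(1) by (simp add: sum_nonneg)
  then show "x k \<le> l"
    using le[of "Suc k"] by (rule order_trans)
qed

text \<open>The absolute value of the sum is at most \<open>s\<close> times a partial sum of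
  \<open>p\<close>. The coefficients are bounded only from \<open>m\<close> on, so that tails with
  null coefficients become uniformly small.\<close>

lemma N_weighted_sum_le:
  fixes p :: "nat \<Rightarrow> 'a"
  assumes "\<And>k. 0 \<le> p k" "\<And>n. N (\<Sum>k<n. p k) \<le> M" "\<And>k. m \<le> k \<Longrightarrow> \<bar>a k\<bar> \<le> s" "0 \<le> s"
  shows "N (\<Sum>k\<in>{m..<n}. a k *\<^sub>R p k) \<le> s * M"
proof -
  have "\<bar>\<Sum>k\<in>{m..<n}. a k *\<^sub>R p k\<bar> \<le> (\<Sum>k\<in>{m..<n}. s *\<^sub>R p k)"
  proof (intro abs_leI)
    have "a k *\<^sub>R p k \<le> s *\<^sub>R p k" "- (a k *\<^sub>R p k) \<le> s *\<^sub>R p k" if "m \<le> k" for k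
      using assms(1)[of k] assms(3)[OF that] scaleR_right_mono[of "a k" s "p k"] scaleR_right_mono[of "- a k" s "p k"]
      by auto
    then show "(\<Sum>k\<in>{m..<n}. a k *\<^sub>R p k) \<le> (\<Sum>k\<in>{m..<n}. s *\<^sub>R p k)"
      "- (\<Sum>k\<in>{m..<n}. a k *\<^sub>R p k) \<le> (\<Sum>k\<in>{m..<n}. s *\<^sub>R p k)"
      unfolding sum_negf[symmetric] by (intro sum_mono; simp)+
  qed
  also have "\<dots> = s *\<^sub>R (\<Sum>k\<in>{m..<n}. p k)"
    by (simp add: scaleR_right.sum)
  also have "\<dots> \<le> s *\<^sub>R (\<Sum>k<n. p k)"
    using assms(1,4) by (intro scaleR_left_mono sum_mono2 finite_lessThan) auto
  also have "\<dots> \<le> \<bar>s *\<^sub>R (\<Sum>k<n. p k)\<bar>"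
    by (rule abs_ge_self)
  finally have "N (\<Sum>k\<in>{m..<n}. a k *\<^sub>R p k) \<le> N (s *\<^sub>R (\<Sum>k<n. p k))"
    by (rule lattice_norm)
  also have "\<dots> \<le> s * M"
    using assms(2,4) by (simp add: scale mult_left_mono)
  finally show ?thesis .
qed

lemma null_weights_convergent:
  fixes p :: "nat \<Rightarrow> 'a"
  assumes "\<And>k. 0 \<le> p k" "\<And>n. N (\<Sum>k<n. p k) \<le> M" "a \<longlonglongrightarrow> (0::real)"
  obtains l where "(\<lambda>n. N ((\<Sum>k<n. a k *\<^sub>R p k) - l)) \<longlonglongrightarrow> 0"
proof (rule series_convergent)
  fix e :: real
  assume "e > 0"
  have "0 \<le> M"
    using assms(2)[of 0] by simp
  \<comment> \<open>\<open>M + 1\<close> in place of \<open>M\<close> gives \<open>s * M < e\<close>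
    and avoids division by zero.\<close>
  define s where "s = e / (M + 1)"
  have "s > 0"
    using \<open>0 \<le> M\<close> \<open>e > 0\<close> by (simp add: s_def)
  then obtain m0 where m0: "\<And>k. k \<ge> m0 \<Longrightarrow> \<bar>a k\<bar> < s"
    using LIMSEQ_D[OF assms(3)] by auto
  have "s * M < e"
    using \<open>0 \<le> M\<close> \<open>e > 0\<close> by (simp add: s_def field_simps)
  have "N (\<Sum>k\<in>{m..<n}. a k *\<^sub>R p k) < e" if "m \<ge> m0" for m n
  proof -
    have "N (\<Sum>k\<in>{m..<n}. a k *\<^sub>R p k) \<le> s * M"
      using m0 that \<open>s > 0\<close> by (intro N_weighted_sum_le assms) (auto intro: less_imp_le)
    then show ?thesis
      using \<open>s * M < e\<close> by simp
  qed
  then show "\<exists>m0. \<forall>m\<ge>m0. \<forall>n. N (\<Sum>k\<in>{m..<n}. a k *\<^sub>R p k) < e"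
    by blast
qed

text \<open>Each use of the quasi-triangle inequality costs a factor \<open>C\<close>; the ratio
  \<open>1 / (2 * C)\<close> absorbs it.\<close>

lemma geometric_series_convergent:
  assumes C: "1 \<le> C" "\<And>x y. N (x + y) \<le> C * max (N x) (N y)"
    and y: "\<And>k. N (y k) \<le> (1 / (2 * C))^k"
  obtains l where "(\<lambda>n. N ((\<Sum>k<n. y k) - l)) \<longlonglongrightarrow> 0"
proof (rule series_convergent)
  let ?s = "1 / (2 * C)"
  \<comment> \<open>The induction peels off the first term and applies the bound at
    \<open>Suc m\<close> to the rest, so \<open>m\<close> must be arbitrary. As
    \<open>C * ?s^Suc m \<le> ?s^m\<close>, the constant does not grow.\<close>
  have tail: "N (\<Sum>k\<in>{m..<m + j}. y k) \<le> C * ?s^m" for m j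
  proof (induction j arbitrary: m)
    case (Suc j)
    have "(\<Sum>k\<in>{m..<m + Suc j}. y k) = y m + (\<Sum>k\<in>{Suc m..<Suc m + j}. y k)"
      by (simp add: sum.atLeast_Suc_lessThan)
    then have "N (\<Sum>k\<in>{m..<m + Suc j}. y k) \<le> C * max (N (y m)) (N (\<Sum>k\<in>{Suc m..<Suc m + j}. y k))"
      using C(2) by simp
    also have "\<dots> \<le> C * max (?s^m) (C * ?s^Suc m)"
      using C(1) by (intro mult_left_mono[OF max.mono[OF y Suc]]) simp
    also have "C * ?s^Suc m \<le> ?s^m"
      using C(1) by (simp add: field_simps)
    then have "C * max (?s^m) (C * ?s^Suc m) = C * ?s^m"
      by simp
    finally show ?case .
  qed (use C in simp)
  fix e :: real
  assume "e > 0"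
  have "(\<lambda>m. C * ?s^m) \<longlonglongrightarrow> C * 0"
    using C(1) by (intro tendsto_intros LIMSEQ_power_zero) (simp add: divide_less_eq)
  then obtain m0 where m0: "\<And>m. m \<ge> m0 \<Longrightarrow> C * ?s^m < e"
    using LIMSEQ_D[of "\<lambda>m. C * ?s^m" 0 e] \<open>e > 0\<close> by (metis abs_less_iff diff_zero mult_zero_right real_norm_def)
  have "N (\<Sum>k\<in>{m..<n}. y k) < e" if "m \<ge> m0" for m n
  proof -
    have "N (\<Sum>k\<in>{m..<n}. y k) \<le> C * ?s^m"
    proof (cases "m \<le> n")
      case True
      then show ?thesis
        using tail[of m "n - m"] by simp
    qed (use C in simp)
    then show ?thesis
      using m0[OF that] by simp
  qed
  then show "\<exists>m0. \<forall>m\<ge>m0. \<forall>n. N (\<Sum>k\<in>{m..<n}. y k) < e"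
    by blast
qed

lemma null_seq_summable_subseq:
  assumes "(\<lambda>k. N (y k)) \<longlonglongrightarrow> 0"
  obtains r :: "nat \<Rightarrow> nat" and l where "strict_mono r" "(\<lambda>n. N ((\<Sum>k<n. y (r k)) - l)) \<longlonglongrightarrow> 0"
proof -
  obtain C where C: "1 \<le> C" "\<And>x y. N (x + y) \<le> C * max (N x) (N y)"
    using quasi_triangle_ge_1 by blast
  have "\<exists>i\<ge>n. N (y i) \<le> (1 / (2 * C))^k" for k n
  proof -
    have "(1 / (2 * C))^k > 0"
      using C(1) by simp
    then obtain m where "\<And>i. i \<ge> m \<Longrightarrow> N (y i) < (1 / (2 * C))^k"
      using LIMSEQ_D[OF assms] by auto
    then show ?thesis
      by (metis less_imp_le nat_le_linear)
  qed
  then obtain r :: "nat \<Rightarrow> nat" where r: "strict_mono r" "\<And>k. N (y (r k)) \<le> (1 / (2 * C))^k"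
    using frequently_subseq[of "\<lambda>k i. N (y i) \<le> (1 / (2 * C))^k"] by blast
  show ?thesis
    by (rule geometric_series_convergent[OF C r(2)]) (rule that[OF r(1)])
qed

section \<open>Finding \<open>c0\<close> bases among subsequences\<close>

definition c0_basis :: "(nat \<Rightarrow> 'a) \<Rightarrow> bool"
  where "c0_basis e \<longleftrightarrow> disjoint_seq e \<and> (\<exists>c>0. \<forall>i. c \<le> N (e i))
    \<and> (\<exists>M. \<forall>n. N (\<Sum>i<n. e i) \<le> M)"

lemma N_sum_subseq_le:
  fixes r :: "nat \<Rightarrow> nat"
  assumes "disjoint_seq e" "strict_mono r" "\<And>n. N (\<Sum>i<n. e i) \<le> M"
  shows "N (\<Sum>i<n. e (r i)) \<le> M"
proof -
  have "inj_on r {..<n}"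
    using assms(2) by (meson strict_mono_imp_inj_on inj_on_subset subset_UNIV)
  then have "(\<Sum>i<n. e (r i)) = sum e (r ` {..<n})"
    by (simp add: sum.reindex)
  also have "\<dots> \<le> (\<Sum>i<r n. e i)"
    using assms by (intro disjoint_seq_sum_mono) (auto simp: strict_mono_less)
  finally have "(\<Sum>i<n. e (r i)) \<le> (\<Sum>i<r n. e i)" .
  moreover have "0 \<le> (\<Sum>i<n. e (r i))"
    using assms(1) by (simp add: disjoint_seq_nonneg sum_nonneg)
  ultimately have "N (\<Sum>i<n. e (r i)) \<le> N (\<Sum>i<r n. e i)"
    by (intro mono)
  then show ?thesis
    using assms(3)[of "r n"] by simp
qed

lemma c0_basisI:
  assumes "disjoint_seq e" "c > 0" "\<And>i. c \<le> N (e i)" "\<And>n. N (\<Sum>i<n. e i) \<le> M"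
  shows "c0_basis e"
  using assms unfolding c0_basis_def by (intro conjI exI[of _ c] exI[of _ M]) auto

lemma c0_basisE:
  assumes "c0_basis e"
  obtains c M where "disjoint_seq e" "c > 0" "\<And>i. c \<le> N (e i)" "\<And>n. N (\<Sum>i<n. e i) \<le> M"
  using assms unfolding c0_basis_def by auto

lemma c0_basis_subseq:
  assumes "c0_basis e" "strict_mono r"
  shows "c0_basis (\<lambda>i. e (r i))"
proof -
  obtain c M where e: "disjoint_seq e" "c > 0" "\<And>i. c \<le> N (e i)" "\<And>n. N (\<Sum>i<n. e i) \<le> M"
    using c0_basisE[OF assms(1)] by metis
  show ?thesis
    by (rule c0_basisI[OF disjoint_seq_subseq[OF e(1) strict_mono_imp_inj_on[OF assms(2)]] e(2) e(3)
      N_sum_subseq_le[OF e(1) assms(2) e(4)]])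
qed

text \<open>A sequence that is not null has a subsequence bounded away from 0, and the bound on
  partial sums passes to it by positivity.\<close>

lemma c0_basis_of_bounded_sums:
  assumes f: "disjoint_seq f" "\<And>n. N (\<Sum>i<n. f i) \<le> M"
    and "\<not> (\<lambda>i. N (f i)) \<longlonglongrightarrow> 0"
  obtains g where "c0_basis g"
proof -
  obtain c where c: "c > 0" "\<And>n. \<exists>i\<ge>n. c \<le> N (f i)"
    using assms(3) unfolding LIMSEQ_iff by (auto simp: not_less)
  obtain r :: "nat \<Rightarrow> nat" where r: "strict_mono r" "\<And>k. c \<le> N (f (r k))"
    using frequently_subseq[of "\<lambda>_ i. c \<le> N (f i)", OF c(2)] by auto
  show ?thesis
    by (rule that[OF c0_basisI[OF disjoint_seq_subseq[OF f(1) strict_mono_imp_inj_on[OF r(1)]] c(1) r(2)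
      N_sum_subseq_le[OF f(1) r(1) f(2)]]])
qed

lemma c0_basis_of_order_bounded:
  assumes "disjoint_seq f" "\<And>i. f i \<le> u" "\<not> (\<lambda>i. N (f i)) \<longlonglongrightarrow> 0"
  obtains g where "c0_basis g"
proof (rule c0_basis_of_bounded_sums[OF assms(1) _ assms(3)])
  fix n
  have "0 \<le> u"
    using assms(2)[of 0] disjoint_seq_nonneg[OF assms(1), of 0] by simp
  then show "N (\<Sum>i<n. f i) \<le> N u"
    using assms by (intro mono disjoint_seq_sum_nonneg disjoint_seq_sum_le) auto
qed

end

section \<open>Order isomorphisms preserve the presence of \<open>c0\<close>\<close>

text \<open>The range is a sublattice rather than the whole space, so that both \<open>c0\<close>
  onto a sublattice and one lattice onto another are covered. \<open>T 0 = 0\<close> is a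
  normalisation, reached by a translation.\<close>

locale order_iso_onto =
  fixes T :: "'e::vector_lattice \<Rightarrow> 'f::vector_lattice" and G :: "'f set"
  assumes zero [simp]: "T 0 = 0"
    and bij: "bij_betw T UNIV G"
    and le_iff [simp]: "T x \<le> T y \<longleftrightarrow> x \<le> y"
    and sublattice: "sublattice G"
begin

lemma range_T: "range T = G"
  using bij by (rule bij_betw_imp_surj_on)

lemma T_in [simp]: "T x \<in> G"
  using range_T by blast

lemma preimage:
  assumes "y \<in> G"
  obtains x where "T x = y"
  using assms range_T by blast

lemma T_nonneg [simp]: "0 \<le> T x \<longleftrightarrow> 0 \<le> x"
  using le_iff[of 0 x] by simp

text \<open>\<open>G\<close> is closed under the ambient lattice operations, so
  \<open>inf (T x) (T y)\<close> has a preimage; as \<open>T\<close> reflects the order, this is a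
  lower bound of \<open>x\<close> and \<open>y\<close>.\<close>

lemma T_inf: "T (inf x y) = inf (T x) (T y)"
proof (rule antisym)
  have "inf (T x) (T y) \<in> G"
    using sublattice by (simp add: sublattice_def)
  then obtain w where w: "T w = inf (T x) (T y)"
    by (rule preimage)
  then have "w \<le> inf x y"
    by (metis inf.bounded_iff inf.cobounded1 inf.cobounded2 le_iff)
  then show "inf (T x) (T y) \<le> T (inf x y)"
    by (simp flip: w)
qed simp

lemma T_sup: "T (sup x y) = sup (T x) (T y)"
proof (rule antisym)
  have "sup (T x) (T y) \<in> G"
    using sublattice by (simp add: sublattice_def)
  then obtain w where w: "T w = sup (T x) (T y)"
    by (rule preimage)
  then have "sup x y \<le> w"
    by (metis le_sup_iff sup.cobounded1 sup.cobounded2 le_iff)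
  then show "T (sup x y) \<le> sup (T x) (T y)"
    by (simp flip: w)
qed simp

lemma disjoint_seq_T: "disjoint_seq f \<Longrightarrow> disjoint_seq (\<lambda>i. T (f i))"
  by (simp add: disjoint_seq_def flip: T_inf)

text \<open>A sum of disjoint elements is a supremum, which \<open>T\<close> preserves. In the
  transfer this takes the place of linearity.\<close>

lemma T_add: "inf x y = 0 \<Longrightarrow> T (x + y) = T x + T y"
  by (metis T_inf T_sup disjoint_add_eq_sup zero)

lemma T_sum:
  assumes "disjoint_seq f" "finite A"
  shows "T (\<Sum>i\<in>A. f i) = (\<Sum>i\<in>A. T (f i))"
  using assms(2)
proof (induction A)
  case (insert i A)
  have "inf (f i) (sum f A) = 0"
    using disjoint_seq_inf_sum[OF assms(1), of "{i}" A] insert by simp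
  then show ?case
    using insert by (simp add: T_add)
qed simp

text \<open>Passing to the increments at a base point \<open>p\<close> allows results about
  \<open>T\<close> near 0 to be applied near \<open>p\<close>. Subtracting \<open>T p\<close>
  restores the normalisation and stays in the subspace \<open>G\<close>.\<close>

lemma translate: "order_iso_onto (\<lambda>x. T (p + x) - T p) G"
proof
  have sub: "subspace G"
    using sublattice by (simp add: sublattice_def)
  show "bij_betw (\<lambda>x. T (p + x) - T p) UNIV G"
    unfolding bij_betw_def
  proof (intro conjI equalityI subsetI)
    show "inj (\<lambda>x. T (p + x) - T p)"
      using bij_betw_imp_inj_on[OF bij] by (intro injI) (auto simp: inj_eq)
    show "y \<in> G" if "y \<in> range (\<lambda>x. T (p + x) - T p)" for y
      using that sub by (auto intro: subspace_diff)
    show "y \<in> range (\<lambda>x. T (p + x) - T p)" if "y \<in> G" for y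
    proof -
      have "y + T p \<in> G"
        using that sub by (simp add: subspace_add)
      then obtain x where "T x = y + T p"
        by (rule preimage)
      then show ?thesis
        by (intro image_eqI[of _ _ "x - p"]) auto
    qed
  qed
  show "T (p + x) - T p \<le> T (p + y) - T p \<longleftrightarrow> x \<le> y" for x y
    by simp
qed (simp_all add: sublattice)

end

section \<open>Transfer of \<open>c0\<close> bases under nonlinear order isomorphisms\<close>

locale banach_order_iso = E: quasi_banach_lattice NE + F: quasi_banach_lattice NF + order_iso_onto T G
  for NE :: "'e::vector_lattice \<Rightarrow> real" and NF :: "'f::vector_lattice \<Rightarrow> real"
    and T :: "'e \<Rightarrow> 'f" and G +
  assumes closed: "closedin (quasi_norm_topology NF) G"
begin

lemma banach_order_iso_translate: "banach_order_iso NE NF (\<lambda>x. T (p + x) - T p) G"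
  by (intro banach_order_iso.intro E.quasi_banach_lattice_axioms F.quasi_banach_lattice_axioms translate
    banach_order_iso_axioms.intro closed)

text \<open>
  Otherwise there are consecutive blocks which, with coefficients tending to zero, are order
  bounded in \<open>E\<close> but whose images are not null.
\<close>

lemma bounded_tail_sums:
  assumes g: "E.c0_basis g" and no: "\<nexists>f. F.c0_basis f"
  obtains \<delta> n where "\<delta> > 0" "\<And>m. NF (\<Sum>i\<in>{n..<m}. T (\<delta> *\<^sub>R g i)) \<le> 1"
proof (rule ccontr)
  assume neg: "\<not> thesis"
  obtain c M where dj: "disjoint_seq g" and M: "\<And>n. NE (\<Sum>i<n. g i) \<le> M"
    using g by (rule E.c0_basisE) metis
  define t where "t k = 1 / real (Suc k)" for k
  have t: "t k > 0" for k
    by (simp add: t_def)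
  have "\<exists>m. NF (\<Sum>i\<in>{n..<m}. T (t k *\<^sub>R g i)) > 1" for k n
    using neg that[of "t k" n] t[of k] by (metis not_le)
  then obtain m where m: "\<And>k n. NF (\<Sum>i\<in>{n..<m k n}. T (t k *\<^sub>R g i)) > 1"
    by metis
  \<comment> \<open>\<open>r\<close> lays blocks end to end: starting at \<open>r k\<close>, the
    block with coefficient \<open>t k\<close> runs until its image exceeds 1 in \<open>NF\<close>.
    In particular no block is empty.\<close>
  define r where "r = rec_nat 0 m"
  have r: "r (Suc k) = m k (r k)" "r 0 = 0" for k
    by (simp_all add: r_def)
  have "r k < r (Suc k)" for k
  proof (rule ccontr)
    assume "\<not> r k < r (Suc k)"
    then show False
      using m[of k "r k"] by (simp add: r)
  qed
  then have "mono r"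
    by (simp add: less_imp_le mono_iff_le_Suc)
  define p where "p k = (\<Sum>i\<in>{r k..<r (Suc k)}. g i)" for k
  have p: "disjoint_seq p"
    unfolding p_def using dj \<open>mono r\<close> by (rule disjoint_seq_blocks)
  have "NE (\<Sum>k<n. p k) \<le> M" for n
    using M[of "r n"] unfolding p_def sum_blocks[OF \<open>mono r\<close>] by (simp add: r(2) atLeast0LessThan)
  moreover have "t \<longlonglongrightarrow> 0"
    unfolding t_def by (rule LIMSEQ_Suc[OF lim_1_over_n])
  \<comment> \<open>The blocks have bounded sums and the coefficients are null, so the series
    converges; its sum \<open>u\<close> is the required order bound.\<close>
  ultimately obtain u where u: "(\<lambda>n. NE ((\<Sum>k<n. t k *\<^sub>R p k) - u)) \<longlonglongrightarrow> 0"
    using E.null_weights_convergent[where p = p and M = M and a = t] disjoint_seq_nonneg[OF p] by blast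
  have tp: "disjoint_seq (\<lambda>k. t k *\<^sub>R p k)"
    using disjoint_seq_scaleR[OF p, of t] t by (simp add: less_imp_le)
  have "t k *\<^sub>R p k \<le> u" for k
    by (rule E.series_term_le_limit(2)[OF disjoint_seq_nonneg[OF tp] u])
  then have "T (t k *\<^sub>R p k) \<le> T u" for k
    by simp
  moreover have "\<not> (\<lambda>k. NF (T (t k *\<^sub>R p k))) \<longlonglongrightarrow> 0"
  proof
    assume "(\<lambda>k. NF (T (t k *\<^sub>R p k))) \<longlonglongrightarrow> 0"
    then obtain k where "NF (T (t k *\<^sub>R p k)) < 1"
      using LIMSEQ_D[of "\<lambda>k. NF (T (t k *\<^sub>R p k))" 0 1] by auto
    moreover have "T (t k *\<^sub>R p k) = (\<Sum>i\<in>{r k..<m k (r k)}. T (t k *\<^sub>R g i))"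
    proof -
      have "T (\<Sum>i\<in>{r k..<r (Suc k)}. t k *\<^sub>R g i) = (\<Sum>i\<in>{r k..<r (Suc k)}. T (t k *\<^sub>R g i))"
        using disjoint_seq_scaleR[OF dj, of "\<lambda>_. t k"] t[of k] by (intro T_sum) auto
      then show ?thesis
        by (simp add: p_def scaleR_right.sum r)
    qed
    ultimately show False
      using m[of k "r k"] by simp
  qed
  ultimately obtain f where "F.c0_basis f"
    using F.c0_basis_of_order_bounded[OF disjoint_seq_T[OF tp]] by blast
  then show False
    using no by blast
qed

text \<open>From some index on, the images have bounded partial sums; were they not null, a
  subsequence would be a \<open>c0\<close> basis of the target.\<close>

lemma small_multiple:
  assumes g: "E.c0_basis g" and no: "\<nexists>f. F.c0_basis f"
  obtains \<delta> where "\<delta> > 0" "(\<lambda>i. NF (T (\<delta> *\<^sub>R g i))) \<longlonglongrightarrow> 0"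
proof -
  obtain \<delta> n where \<delta>: "\<delta> > 0" and bd: "\<And>m. NF (\<Sum>i\<in>{n..<m}. T (\<delta> *\<^sub>R g i)) \<le> 1"
    using bounded_tail_sums[OF assms] by blast
  have dj: "disjoint_seq g"
    using g by (rule E.c0_basisE)
  have dj': "disjoint_seq (\<lambda>i. T (\<delta> *\<^sub>R g i))"
    using disjoint_seq_scaleR[OF dj, of "\<lambda>_. \<delta>"] \<delta> by (intro disjoint_seq_T) auto
  define f where "f i = T (\<delta> *\<^sub>R g (i + n))" for i
  have f: "disjoint_seq f"
    using disjoint_seq_subseq[OF dj', of "\<lambda>i. i + n"] by (simp add: f_def[abs_def] inj_on_def)
  have "NF (\<Sum>i<k. f i) \<le> 1" for k
    using bd[of "k + n"] sum.shift_bounds_nat_ivl[of "\<lambda>i. T (\<delta> *\<^sub>R g i)" 0 n k]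
    by (simp add: f_def atLeast0LessThan)
  then have "(\<lambda>i. NF (f i)) \<longlonglongrightarrow> 0"
    using F.c0_basis_of_bounded_sums[OF f] no by blast
  then have "(\<lambda>i. NF (T (\<delta> *\<^sub>R g i))) \<longlonglongrightarrow> 0"
    unfolding f_def by (rule LIMSEQ_offset)
  with \<delta> show ?thesis
    by (rule that)
qed

text \<open>\<open>G\<close> is closed, so the sum of a convergent series of images lies in the
  range of \<open>T\<close>. Its preimage is a common upper bound in the domain, although no series
  converges there.\<close>

lemma summable_subseq_preimage:
  assumes "disjoint_seq z" "(\<lambda>k. NF (T (z k))) \<longlonglongrightarrow> 0"
  obtains r :: "nat \<Rightarrow> nat" and x where "strict_mono r"
    "(\<lambda>n. NF ((\<Sum>k<n. T (z (r k))) - T x)) \<longlonglongrightarrow> 0" "\<And>k. z (r k) \<le> x"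
proof -
  obtain r :: "nat \<Rightarrow> nat" and l where r: "strict_mono r"
    and l: "(\<lambda>n. NF ((\<Sum>k<n. T (z (r k))) - l)) \<longlonglongrightarrow> 0"
    using F.null_seq_summable_subseq[OF assms(2)] by blast
  have "(\<Sum>k<n. T (z (r k))) \<in> G" for n
    using sublattice by (auto simp: sublattice_def intro: subspace_sum)
  then have "l \<in> G"
    using F.closedin_limit[OF closed _ l] by blast
  then obtain x where x: "T x = l"
    by (rule preimage)
  have "T (z (r k)) \<le> l" for k
    using F.series_term_le_limit(2)[OF _ l] assms(1) by (simp add: disjoint_seq_nonneg)
  then have "z (r k) \<le> x" for k
    by (simp flip: x)
  then show ?thesis
    using l by (intro that[OF r, of x]) (simp_all add: x)
qed

lemma c0_basis_transfer:
  assumes e: "E.c0_basis e"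
  shows "\<exists>f. F.c0_basis f"
proof (rule ccontr)
  assume no: "\<nexists>f. F.c0_basis f"
  obtain c where dj: "disjoint_seq e" and c: "c > 0" "\<And>i. c \<le> NE (e i)"
    using e by (rule E.c0_basisE) metis
  have pos: "0 \<le> e i" for i
    using dj by (rule disjoint_seq_nonneg)
  have NF_mono: "NF (T (a *\<^sub>R e i)) \<le> NF (T (b *\<^sub>R e i))" if "0 \<le> a" "a \<le> b" for a b i
    using that pos[of i] by (intro F.mono) (auto simp: scaleR_nonneg_nonneg intro: scaleR_right_mono)
  have lim: "(\<lambda>k. NF (y k)) \<longlonglongrightarrow> 0" if "\<And>k. NF (y k) < 1 / real (Suc k)" for y
    using that by (intro tendsto_0_le_real[OF _ _ LIMSEQ_Suc[OF lim_1_over_n]]) (auto intro: less_imp_le)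
  have sub: "disjoint_seq (\<lambda>k. a k *\<^sub>R e (i k))" if "strict_mono i" "\<And>k. 0 \<le> a k" for a and i :: "nat \<Rightarrow> nat"
    using disjoint_seq_scaleR[OF disjoint_seq_subseq[OF dj strict_mono_imp_inj_on[OF that(1)]] that(2)] .
  \<comment> \<open>Membership of \<open>r\<close> means that \<open>T (r *\<^sub>R e i)\<close> has
    a null subsequence; arbitrarily late indices are demanded so that the choice can be made
    strictly increasing.\<close>
  define A where "A = {r. 0 \<le> r \<and> (\<forall>\<epsilon>>0. \<forall>n. \<exists>i\<ge>n. NF (T (r *\<^sub>R e i)) < \<epsilon>)}"
  have A: "\<exists>i\<ge>n. NF (T (r *\<^sub>R e i)) < \<epsilon>" if "r \<in> A" "\<epsilon> > 0" for r \<epsilon> n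
    using that by (simp add: A_def)
  have "0 \<in> A"
    by (auto simp: A_def)
  have "bdd_above A"
  proof (rule ccontr)
    assume "\<not> bdd_above A"
    then have unb: "\<exists>r\<in>A. real k < r" for k
      unfolding bdd_above_def by (meson not_le)
    have "\<exists>i\<ge>n. NF (T (real k *\<^sub>R e i)) < 1 / real (Suc k)" for k n
    proof -
      obtain r where "r \<in> A" "real k < r"
        using unb by blast
      moreover obtain i where "i \<ge> n" "NF (T (r *\<^sub>R e i)) < 1 / real (Suc k)"
        using A[OF \<open>r \<in> A\<close>, of "1 / real (Suc k)" n] by auto
      ultimately show ?thesis
        using NF_mono[of "real k" r i] by (intro exI[of _ i]) auto
    qed
    then obtain i :: "nat \<Rightarrow> nat" where i: "strict_mono i"
      "\<And>k. NF (T (real k *\<^sub>R e (i k))) < 1 / real (Suc k)"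
      using frequently_subseq[of "\<lambda>k i. NF (T (real k *\<^sub>R e i)) < 1 / real (Suc k)"] by auto
    \<comment> \<open>A single \<open>x\<close> would dominate multiples of the \<open>e i\<close>
      whose coefficients tend to infinity, while the \<open>e i\<close> have norm at least
      \<open>c\<close>.\<close>
    obtain r :: "nat \<Rightarrow> nat" and x where r: "strict_mono r"
      and x: "\<And>k. real (r k) *\<^sub>R e (i (r k)) \<le> x"
      using summable_subseq_preimage[OF sub[OF i(1) of_nat_0_le_iff] lim[OF i(2)]] by blast
    have "real k * c \<le> NE x" for k
    proof -
      have "real k * c \<le> real (r k) * NE (e (i (r k)))"
        using strict_mono_imp_increasing[OF r, of k] c by (intro mult_mono) auto
      also have "\<dots> = NE (real (r k) *\<^sub>R e (i (r k)))"
        by (simp add: E.scale)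
      also have "\<dots> \<le> NE x"
        using x pos by (intro E.mono) (auto simp: scaleR_nonneg_nonneg)
      finally show ?thesis .
    qed
    then show False
      using reals_Archimedean3[OF c(1)] by (meson not_le)
  qed
  define L where "L = Sup A"
  have "\<exists>r\<in>A. L - 1 / real (Suc k) < r" for k
    using less_cSup_iff[of A "L - 1 / real (Suc k)"] \<open>0 \<in> A\<close> \<open>bdd_above A\<close> unfolding L_def by fastforce
  \<comment> \<open>\<open>L\<close> itself need not belong to \<open>A\<close>, so elements of
    \<open>A\<close> converging to it are used.\<close>
  then obtain a where a: "\<And>k. a k \<in> A" "\<And>k. L - 1 / real (Suc k) < a k"
    by metis
  have a_nonneg: "0 \<le> a k" for k
    using a(1)[of k] by (simp add: A_def)
  have "\<exists>i\<ge>n. NF (T (a k *\<^sub>R e i)) < 1 / real (Suc k)" for k n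
    by (rule A[OF a(1)]) simp
  then obtain i :: "nat \<Rightarrow> nat" where i: "strict_mono i"
    "\<And>k. NF (T (a k *\<^sub>R e (i k))) < 1 / real (Suc k)"
    using frequently_subseq[of "\<lambda>k i. NF (T (a k *\<^sub>R e i)) < 1 / real (Suc k)"] by auto
  obtain r :: "nat \<Rightarrow> nat" and x where r: "strict_mono r"
    and lx: "(\<lambda>n. NF ((\<Sum>k<n. T (a (r k) *\<^sub>R e (i (r k)))) - T x)) \<longlonglongrightarrow> 0"
    and x: "\<And>k. a (r k) *\<^sub>R e (i (r k)) \<le> x"
    using summable_subseq_preimage[OF sub[OF i(1) a_nonneg] lim[OF i(2)]] by blast
  define g b where "g k = e (i (r k))" and "b k = a (r k)" for k
  have ir: "strict_mono (\<lambda>k. i (r k))"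
    using i(1) r by (simp add: strict_mono_def)
  have g: "E.c0_basis g"
    unfolding g_def using e ir by (rule E.c0_basis_subseq)
  have g_pos: "0 \<le> g k" for k
    by (simp add: g_def pos)
  have b_nonneg: "0 \<le> b k" for k
    by (simp add: b_def a_nonneg)
  \<comment> \<open>Recentring at \<open>x\<close> makes \<open>small_multiple\<close> available for
    the increments of \<open>T\<close> at \<open>x\<close>.\<close>
  interpret S: banach_order_iso NE NF "\<lambda>z. T (x + z) - T x" G
    by (rule banach_order_iso_translate)
  obtain \<delta> where \<delta>: "\<delta> > 0" and l\<delta>: "(\<lambda>k. NF (T (x + \<delta> *\<^sub>R g k) - T x)) \<longlonglongrightarrow> 0"
    using S.small_multiple[OF g no] by blast
  define w where "w k = T ((b k + \<delta>) *\<^sub>R g k)" for k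
  have w_nonneg: "0 \<le> w k" for k
    using b_nonneg[of k] \<delta> g_pos[of k] by (simp add: w_def scaleR_nonneg_nonneg)
  \<comment> \<open>\<open>w k\<close> lies below \<open>T (x + \<delta> *\<^sub>R g k)\<close>, the
    sum of the increment \<open>?D\<close>, the remainder \<open>?R\<close>, the term
    \<open>?z\<close> and the earlier terms \<open>?S\<close>. It is disjoint from
    \<open>?S\<close>, so subadditivity of \<open>inf\<close> leaves the other three, all null as
    \<open>k\<close> grows. Summing to \<open>Suc k\<close> in \<open>?R\<close> is what separates
    \<open>?z\<close>.\<close>
  have w_le: "w k \<le> (T (x + \<delta> *\<^sub>R g k) - T x) + ((T x - (\<Sum>j<Suc k. T (b j *\<^sub>R g j))) + T (b k *\<^sub>R g k))" for k
  proof -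
    let ?D = "T (x + \<delta> *\<^sub>R g k) - T x" and ?R = "T x - (\<Sum>j<Suc k. T (b j *\<^sub>R g j))"
      and ?S = "\<Sum>j<k. T (b j *\<^sub>R g j)" and ?z = "T (b k *\<^sub>R g k)"
    have z_nonneg: "0 \<le> T (b j *\<^sub>R g j)" for j
      using b_nonneg g_pos by (simp add: scaleR_nonneg_nonneg)
    have nonneg: "0 \<le> ?D" "0 \<le> ?R" "0 \<le> ?S" "0 \<le> ?z"
    proof -
      show "0 \<le> ?D"
        using \<delta> g_pos[of k] by (simp add: scaleR_nonneg_nonneg)
      have "(\<Sum>j<Suc k. T (b j *\<^sub>R g j)) \<le> T x"
        using lx by (intro F.series_term_le_limit(1) z_nonneg) (simp add: g_def b_def)
      then show "0 \<le> ?R"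
        by simp
    qed (simp_all only: z_nonneg sum_nonneg)
    have "b k *\<^sub>R g k \<le> x"
      using x[of k] by (simp add: g_def b_def)
    then have "w k \<le> T (x + \<delta> *\<^sub>R g k)"
      by (simp add: w_def scaleR_add_left)
    also have "\<dots> = ?D + (?R + (?z + ?S))"
      by simp
    finally have "w k = inf (?D + (?R + (?z + ?S))) (w k)"
      by (simp add: inf_absorb2)
    also have "\<dots> \<le> inf ?D (w k) + inf (?R + (?z + ?S)) (w k)"
      using nonneg w_nonneg by (intro inf_add_le add_nonneg_nonneg)
    also have "inf (?R + (?z + ?S)) (w k) \<le> inf ?R (w k) + inf (?z + ?S) (w k)"
      using nonneg w_nonneg by (intro inf_add_le add_nonneg_nonneg)
    also have "inf (?z + ?S) (w k) \<le> inf ?z (w k) + inf ?S (w k)"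
      using nonneg w_nonneg by (intro inf_add_le)
    also have "inf ?S (w k) = 0"
    proof (rule inf_sum_eq_0)
      fix j
      assume "j \<in> {..<k}"
      then have "i (r j) \<noteq> i (r k)"
        using strict_mono_less[OF ir, of j k] by simp
      then have "inf (g j) (g k) = 0"
        unfolding g_def by (rule disjoint_seq_inf[OF dj])
      then have "inf (b j *\<^sub>R g j) ((b k + \<delta>) *\<^sub>R g k) = 0"
        using b_nonneg[of j] b_nonneg[of k] \<delta> g_pos by (intro inf_scaleR_eq_0) auto
      then show "inf (T (b j *\<^sub>R g j)) (w k) = 0"
        unfolding w_def by (simp flip: T_inf)
    qed (use z_nonneg w_nonneg in auto)
    finally have "w k \<le> inf ?D (w k) + (inf ?R (w k) + (inf ?z (w k) + 0))"
      by simp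
    also have "\<dots> \<le> ?D + (?R + (?z + 0))"
      by (intro add_mono inf.cobounded1 order_refl)
    finally show ?thesis
      by simp
  qed
  have lw: "(\<lambda>k. NF (w k)) \<longlonglongrightarrow> 0"
  proof (rule F.tendsto_le_0[OF _ w_nonneg w_le], intro F.tendsto_add_0 l\<delta>)
    show "(\<lambda>k. NF (T x - (\<Sum>j<Suc k. T (b j *\<^sub>R g j)))) \<longlonglongrightarrow> 0"
      using LIMSEQ_Suc[OF lx] by (simp add: g_def b_def F.diff_commute[of "T x"])
    show "(\<lambda>k. NF (T (b k *\<^sub>R g k))) \<longlonglongrightarrow> 0"
      using LIMSEQ_subseq_LIMSEQ[OF lim[OF i(2)] r] by (simp add: g_def b_def o_def)
  qed
  have "L + \<delta> / 2 \<in> A"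
    unfolding A_def
  proof (intro CollectI conjI allI impI)
    have "0 \<le> L"
      unfolding L_def using \<open>0 \<in> A\<close> \<open>bdd_above A\<close> by (rule cSup_upper)
    then show "0 \<le> L + \<delta> / 2"
      using \<delta> by simp
    fix \<epsilon> :: real and n
    assume "\<epsilon> > 0"
    then have "\<forall>\<^sub>F k in sequentially. NF (w k) < \<epsilon>"
      using lw by (simp add: order_tendstoD)
    moreover have "\<forall>\<^sub>F k in sequentially. 1 / real (Suc k) < \<delta> / 2"
      using \<delta> by (intro order_tendstoD(2)[OF LIMSEQ_Suc[OF lim_1_over_n]]) simp
    ultimately have "\<forall>\<^sub>F k in sequentially. NF (w k) < \<epsilon> \<and> 1 / real (Suc k) < \<delta> / 2 \<and> n \<le> k"
      using eventually_ge_at_top[of n] by eventually_elim simp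
    then obtain k where k: "NF (w k) < \<epsilon>" "1 / real (Suc k) < \<delta> / 2" "n \<le> k"
      unfolding eventually_sequentially by blast
    have "1 / real (Suc (r k)) \<le> 1 / real (Suc k)"
      using strict_mono_imp_increasing[OF r, of k] by (intro divide_left_mono) auto
    \<comment> \<open>Half of \<open>\<delta>\<close> pays for the gap between \<open>b k\<close>
      and \<open>L\<close>; the other half moves past the supremum.\<close>
    then have "L + \<delta> / 2 \<le> b k + \<delta>"
      using a(2)[of "r k"] k(2) by (simp add: b_def)
    then have "NF (T ((L + \<delta> / 2) *\<^sub>R e (i (r k)))) \<le> NF (w k)"
      unfolding w_def g_def using \<open>0 \<le> L + \<delta> / 2\<close> by (intro NF_mono)
    moreover have "n \<le> i (r k)"
      using k(3) strict_mono_imp_increasing[OF ir, of k] by simp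
    ultimately show "\<exists>i\<ge>n. NF (T ((L + \<delta> / 2) *\<^sub>R e i)) < \<epsilon>"
      using k(1) by (intro exI[of _ "i (r k)"]) simp
  qed
  then have "L + \<delta> / 2 \<le> L"
    unfolding L_def using \<open>bdd_above A\<close> by (rule cSup_upper)
  then show False
    using \<delta> by simp
qed

end

section \<open>The linear copy of \<open>c0\<close> spanned by a \<open>c0\<close> basis\<close>

lift_definition c0_unit :: "nat \<Rightarrow> c0" is "\<lambda>i n. if n = i then 1 else 0"
proof (rule tendsto_eventually)
  fix i :: nat
  show "\<forall>\<^sub>F n in sequentially. (if n = i then 1 else 0) = (0::real)"
    using eventually_gt_at_top[of i] by eventually_elim simp
qed

text \<open>The starting point of the transfer; the lower bound on the norms and the bound on the
  partial sums are both 1.\<close>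

lemma c0_basis_c0_unit: "quasi_banach_lattice.c0_basis norm c0_unit"
proof -
  interpret quasi_banach_lattice "norm :: c0 \<Rightarrow> real"
    by (rule quasi_banach_lattice_c0)
  have dj: "disjoint_seq c0_unit"
    unfolding disjoint_seq_def by transfer (auto simp: fun_eq_iff)
  have sum_nth: "c0_nth (sum c0_unit A) n = (if n \<in> A then 1 else 0)" if "finite A" for A n
    using that by (induction A) (auto simp: zero_c0.rep_eq plus_c0.rep_eq c0_unit.rep_eq)
  show ?thesis
  proof (rule c0_basisI[OF dj])
    show "1 \<le> norm (c0_unit i)" for i
      using abs_c0_nth_le_norm[of "c0_unit i" i] by (simp add: c0_unit.rep_eq)
    show "norm (\<Sum>i<n. c0_unit i) \<le> 1" for n
      by (rule norm_c0_le) (simp add: sum_nth)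
  qed simp
qed

text \<open>Splitting the coefficients into positive and negative parts writes the sum as a
  difference of two disjoint positive elements, whose positive part is the first.\<close>

lemma sup_0_disjoint_combination:
  assumes "disjoint_seq f" "finite A"
  shows "sup (\<Sum>k\<in>A. a k *\<^sub>R f k) 0 = (\<Sum>k\<in>A. max (a k) 0 *\<^sub>R f k)"
proof -
  let ?p = "\<lambda>k. max (a k) 0 *\<^sub>R f k" and ?q = "\<lambda>k. max (- a k) 0 *\<^sub>R f k"
  have f: "0 \<le> f k" for k
    using assms(1) by (rule disjoint_seq_nonneg)
  have nonneg: "0 \<le> ?p k" "0 \<le> ?q k" for k
    using f by (auto intro: scaleR_nonneg_nonneg)
  have pq: "inf (?p j) (?q k) = 0" for j k
  proof (cases "j = k")
    case True
    then have "?p j = 0 \<or> ?q k = 0"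
      by (auto simp: max_def)
    then show ?thesis
      using nonneg by (metis inf_absorb1 inf_absorb2)
  next
    case False
    then show ?thesis
      using disjoint_seq_inf[OF assms(1)] f by (intro inf_scaleR_eq_0) auto
  qed
  have "inf (sum ?q A) (?p j) = 0" for j
    using nonneg pq[of j] by (intro inf_sum_eq_0) (auto simp: inf_commute)
  then have "inf (sum ?p A) (sum ?q A) = 0"
    using nonneg by (intro inf_sum_eq_0 sum_nonneg) (auto simp: inf_commute)
  moreover have "a k *\<^sub>R f k = ?p k - ?q k" for k
    by (auto simp: max_def simp flip: scaleR_left_diff_distrib)
  then have "(\<Sum>k\<in>A. a k *\<^sub>R f k) = sum ?p A - sum ?q A"
    by (simp add: sum_subtractf)
  ultimately show ?thesis
    by (simp add: disjoint_diff_sup_0)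
qed

text \<open>Balls need not be open, so the ambient open set is the union of all open sets whose
  trace on \<open>H\<close> lies in \<open>W\<close>; every ball contains an open neighbourhood of
  its centre.\<close>

lemma (in quasi_norm) openin_subtopology_quasi_normI:
  assumes "W \<subseteq> H" "\<And>y. y \<in> W \<Longrightarrow> \<exists>e>0. \<forall>z\<in>H. N (z - y) < e \<longrightarrow> z \<in> W"
  shows "openin (subtopology (quasi_norm_topology N) H) W"
proof -
  define V where "V = \<Union>{V. openin (quasi_norm_topology N) V \<and> V \<inter> H \<subseteq> W}"
  have "openin (quasi_norm_topology N) V"
    unfolding V_def by (rule openin_Union) simp
  moreover have "W \<subseteq> V"
  proof
    fix y
    assume "y \<in> W"
    then obtain e where e: "e > 0" "\<And>z. z \<in> H \<Longrightarrow> N (z - y) < e \<Longrightarrow> z \<in> W"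
      using assms(2) by blast
    obtain U where "openin (quasi_norm_topology N) U" "y \<in> U" "U \<subseteq> {z. N (z - y) < e}"
      using quasi_norm_ball_neighbourhood[OF e(1)] by blast
    then show "y \<in> V"
      unfolding V_def using e(2) by blast
  qed
  then have "W = V \<inter> H"
    using assms(1) by (auto simp: V_def)
  ultimately show ?thesis
    unfolding openin_subtopology by blast
qed

context quasi_banach_lattice
begin

text \<open>\<open>R x\<close> is the sum of the series along \<open>f\<close> with coefficients
  \<open>c0_nth x\<close>. Positive parts pass to the limit from finite combinations. Single terms
  lie below \<open>\<bar>R x\<bar>\<close>, which gives the lower estimate; bounded partial sums
  give the upper one.\<close>

lemma c0_basis_embedding:
  assumes "c0_basis f"
  obtains R :: "c0 \<Rightarrow> 'a" and c K where "linear R"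
    "\<And>x y. R (sup x y) = sup (R x) (R y)" "\<And>x y. R (inf x y) = inf (R x) (R y)"
    "c > 0" "\<And>x. c * norm x \<le> N (R x)" "\<And>x. N (R x) \<le> K * norm x"
proof -
  obtain c M where f: "disjoint_seq f" and c: "c > 0" "\<And>i. c \<le> N (f i)"
    and M: "\<And>n. N (\<Sum>i<n. f i) \<le> M"
    using assms by (rule c0_basisE) metis
  have f_nonneg: "0 \<le> f k" for k
    using f by (rule disjoint_seq_nonneg)
  define P where "P x n = (\<Sum>k<n. c0_nth x k *\<^sub>R f k)" for x n
  have "\<exists>l. (\<lambda>n. N (P x n - l)) \<longlonglongrightarrow> 0" for x
    unfolding P_def by (rule null_weights_convergent[OF f_nonneg M c0_nth_tendsto[of x]]) (rule exI)
  then obtain R where R: "\<And>x. (\<lambda>n. N (P x n - R x)) \<longlonglongrightarrow> 0"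
    by metis
  have R_eq: "R x = l" if "(\<lambda>n. N (P x n - l)) \<longlonglongrightarrow> 0" for x l
    using R[of x] that by (rule limit_unique) simp
  have add: "R (x + y) = R x + R y" for x y
  proof (rule R_eq)
    have "P (x + y) n - (R x + R y) = (P x n - R x) + (P y n - R y)" for n
      by (simp add: P_def plus_c0.rep_eq scaleR_add_left sum.distrib)
    then show "(\<lambda>n. N (P (x + y) n - (R x + R y))) \<longlonglongrightarrow> 0"
      using tendsto_add_0[OF R R] by presburger
  qed
  have scaleR: "R (b *\<^sub>R x) = b *\<^sub>R R x" for b x
  proof (rule R_eq)
    have "P (b *\<^sub>R x) n - b *\<^sub>R R x = b *\<^sub>R (P x n - R x)" for n
      by (simp add: P_def scaleR_c0.rep_eq scaleR_right.sum scaleR_diff_right)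
    then show "(\<lambda>n. N (P (b *\<^sub>R x) n - b *\<^sub>R R x)) \<longlonglongrightarrow> 0"
      using tendsto_scaleR_0[OF R] by presburger
  qed
  have lin: "linear R"
    by (rule linearI[OF add scaleR])
  have sup_0: "R (sup x 0) = sup (R x) 0" for x
  proof (rule R_eq)
    have "P (sup x 0) n = sup (P x n) 0" for n
      using sup_0_disjoint_combination[OF f, of "{..<n}"]
      by (simp add: P_def sup_c0.rep_eq zero_c0.rep_eq)
    then show "(\<lambda>n. N (P (sup x 0) n - sup (R x) 0)) \<longlonglongrightarrow> 0"
      using tendsto_sup_0[OF R] by presburger
  qed
  have sup: "R (sup x y) = sup (R x) (R y)" for x y
    using sup_eq_add_sup_diff[of x y] sup_eq_add_sup_diff[of "R x" "R y"]
    by (metis add linear_diff[OF lin] sup_0)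
  have inf: "R (inf x y) = inf (R x) (R y)" for x y
    using inf_eq_diff_sup[of x y] inf_eq_diff_sup[of "R x" "R y"]
    by (metis add linear_diff[OF lin] sup)
  have abs: "R \<bar>x\<bar> = \<bar>R x\<bar>" for x
    by (simp add: abs_lattice sup linear_neg[OF lin])
  have "c * norm x \<le> N (R x)" for x
  proof -
    have "\<bar>c0_nth x k\<bar> \<le> N (R x) / c" for k
    proof -
      have "c0_nth \<bar>x\<bar> k *\<^sub>R f k \<le> R \<bar>x\<bar>"
        using R[of "\<bar>x\<bar>"] f_nonneg unfolding P_def
        by (intro series_term_le_limit(2)[where x = "\<lambda>k. c0_nth \<bar>x\<bar> k *\<^sub>R f k"])
          (auto simp: abs_c0.rep_eq intro: scaleR_nonneg_nonneg)
      then have le: "\<bar>c0_nth x k\<bar> *\<^sub>R f k \<le> \<bar>R x\<bar>"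
        by (simp add: abs abs_c0.rep_eq)
      have "\<bar>c0_nth x k\<bar> * c \<le> \<bar>c0_nth x k\<bar> * N (f k)"
        using c by (intro mult_left_mono) auto
      also have "\<dots> = N (\<bar>c0_nth x k\<bar> *\<^sub>R f k)"
        by (simp add: scale)
      also have "\<dots> \<le> N \<bar>R x\<bar>"
        using le f_nonneg by (intro mono) (auto intro: scaleR_nonneg_nonneg)
      finally show ?thesis
        using c by (simp add: field_simps)
    qed
    then have "norm x \<le> N (R x) / c"
      by (rule norm_c0_le)
    then show ?thesis
      using c by (simp add: field_simps)
  qed
  moreover obtain C where C: "1 \<le> C" "\<And>x y. N (x + y) \<le> C * max (N x) (N y)"
    using quasi_triangle_ge_1 by blast
  \<comment> \<open>A quasi-norm need not be continuous, so the bound on the partial sums reaches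
    the limit through the quasi-triangle inequality, at the cost of \<open>C\<close>.\<close>
  have "N (R x) \<le> (C * M) * norm x" for x
  proof (rule LIMSEQ_le_const)
    have "0 \<le> M"
      using M[of 0] by simp
    have "(\<lambda>n. C * max (N (P x n - R x)) (norm x * M)) \<longlonglongrightarrow> C * max 0 (norm x * M)"
      by (intro tendsto_intros R)
    then show "(\<lambda>n. C * max (N (P x n - R x)) (norm x * M)) \<longlonglongrightarrow> (C * M) * norm x"
      using \<open>0 \<le> M\<close> by (simp add: max_absorb2 mult_ac)
    have "N (R x) \<le> C * max (N (P x n - R x)) (norm x * M)" for n
    proof -
      have "N (R x) \<le> C * max (N (R x - P x n)) (N (P x n))"
        using C(2)[of "R x - P x n" "P x n"] by simp
      moreover have "N (P x n) \<le> norm x * M"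
        using N_weighted_sum_le[where p = f and M = M and m = 0 and a = "c0_nth x" and s = "norm x" and n = n]
          f_nonneg M abs_c0_nth_le_norm by (simp add: P_def atLeast0LessThan)
      then have "C * max (N (R x - P x n)) (N (P x n)) \<le> C * max (N (P x n - R x)) (norm x * M)"
        using C(1) by (intro mult_left_mono max.mono) (auto simp: diff_commute[of "R x"])
      ultimately show ?thesis
        by (rule order_trans)
    qed
    then show "\<exists>k. \<forall>n\<ge>k. N (R x) \<le> C * max (N (P x n - R x)) (norm x * M)"
      by blast
  qed
  ultimately show ?thesis
    using that lin sup inf c(1) by blast
qed

text \<open>The two-sided estimate makes \<open>R\<close> bicontinuous. The range is closed because
  preimages of a convergent sequence are Cauchy by the lower estimate and \<open>c0\<close> is
  complete.\<close>

lemma c0_basis_imp_sublattice: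
  assumes "c0_basis f"
  shows "\<exists>H. sublattice H \<and> closedin (quasi_norm_topology N) H
           \<and> (\<exists>R :: c0 \<Rightarrow> 'a. linear R \<and> bij_betw R UNIV H
                \<and> (\<forall>x y. R (sup x y) = sup (R x) (R y) \<and> R (inf x y) = inf (R x) (R y))
                \<and> homeomorphic_map euclidean (subtopology (quasi_norm_topology N) H) R)"
proof -
  obtain R :: "c0 \<Rightarrow> 'a" and c K where lin: "linear R"
    and sup: "\<And>x y. R (sup x y) = sup (R x) (R y)" and inf: "\<And>x y. R (inf x y) = inf (R x) (R y)"
    and c: "c > 0" "\<And>x. c * norm x \<le> N (R x)" and K': "\<And>x. N (R x) \<le> K * norm x"
    using c0_basis_embedding[OF assms] by metis
  have diff: "R x - R y = R (x - y)" for x y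
    by (simp add: linear_diff[OF lin])
  have lower: "norm (x - y) \<le> N (R x - R y) / c" for x y
    using c by (simp add: diff field_simps)
  \<comment> \<open>\<open>max K 1\<close> is positive, so radii can later be divided by it.\<close>
  have upper: "N (R x - R y) \<le> max K 1 * norm (x - y)" for x y
    unfolding diff by (rule order_trans[OF K']) (simp add: mult_right_mono)
  have inj: "inj R"
  proof (rule injI)
    fix x y
    assume "R x = R y"
    then show "x = y"
      using lower[of x y] by simp
  qed
  have "sublattice (range R)"
    unfolding sublattice_def
    by (auto simp: linear_subspace_image[OF lin] simp flip: sup inf)
  moreover have "closedin (quasi_norm_topology N) (range R)"
    unfolding closedin_def topspace_quasi_norm_topology openin_quasi_norm_topology
  proof (intro conjI ballI, simp)
    fix y
    assume y: "y \<in> UNIV - range R"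
    show "\<exists>e>0. {z. N (z - y) < e} \<subseteq> UNIV - range R"
    proof (rule ccontr)
      assume neg: "\<not> ?thesis"
      have "\<exists>x. N (R x - y) < 1 / real (Suc n)" for n
      proof -
        have "\<not> {z. N (z - y) < 1 / real (Suc n)} \<subseteq> UNIV - range R"
          using neg by (metis divide_pos_pos of_nat_0_less_iff zero_less_Suc zero_less_one)
        then show ?thesis
          by blast
      qed
      then obtain x where x: "\<And>n. N (R (x n) - y) < 1 / real (Suc n)"
        by metis
      have lim: "(\<lambda>n. N (R (x n) - y)) \<longlonglongrightarrow> 0"
        by (rule tendsto_0_le_real[OF _ _ LIMSEQ_Suc[OF lim_1_over_n]]) (use x in \<open>auto intro: less_imp_le\<close>)
      obtain C where C: "1 \<le> C" "\<And>x y. N (x + y) \<le> C * max (N x) (N y)"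
        using quasi_triangle_ge_1 by blast
      have "Cauchy x"
      proof (rule CauchyI)
        fix e :: real
        assume "e > 0"
        then have "e * c / C > 0"
          using c C by simp
        then obtain n0 where n0: "\<And>n. n \<ge> n0 \<Longrightarrow> N (R (x n) - y) < e * c / C"
          using LIMSEQ_D[OF lim] by force
        have "norm (x m - x n) < e" if "m \<ge> n0" "n \<ge> n0" for m n
        proof -
          have "N (R (x m) - R (x n)) \<le> C * max (N (R (x m) - y)) (N (y - R (x n)))"
            using C(2)[of "R (x m) - y" "y - R (x n)"] by simp
          also have "\<dots> < C * (e * c / C)"
            using n0 that C(1) by (intro mult_strict_left_mono) (auto simp: diff_commute[of y])
          finally have "N (R (x m) - R (x n)) / c < e"
            using C(1) c(1) by (simp add: field_simps)
          then show ?thesis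
            using lower[of "x m" "x n"] by simp
        qed
        then show "\<exists>M. \<forall>m\<ge>M. \<forall>n\<ge>M. norm (x m - x n) < e"
          by blast
      qed
      then obtain a where "x \<longlonglongrightarrow> a"
        using Cauchy_convergent convergent_def by blast
      then have "(\<lambda>n. max K 1 * norm (x n - a)) \<longlonglongrightarrow> 0"
        by (intro tendsto_mult_right_zero) (simp add: LIM_zero tendsto_norm_zero)
      then have "(\<lambda>n. N (R (x n) - R a)) \<longlonglongrightarrow> 0"
        by (rule tendsto_0_le_real[OF nonneg upper])
      then have "R a = y"
        using lim by (rule limit_unique) simp
      then show False
        using y by blast
    qed
  qed
  moreover have "bij_betw R UNIV (range R)"
    using inj by (simp add: bij_betw_def)
  moreover have "homeomorphic_map euclidean (subtopology (quasi_norm_topology N) (range R)) R"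
  proof (rule bijective_open_imp_homeomorphic_map)
    have "open {x. R x \<in> U}" if "openin (quasi_norm_topology N) U" for U
      unfolding open_dist
    proof (intro ballI)
      fix x
      assume "x \<in> {x. R x \<in> U}"
      then have "R x \<in> U"
        by simp
      then have "\<exists>e>0. {z. N (z - R x) < e} \<subseteq> U"
        using that by (simp add: openin_quasi_norm_topology)
      then obtain e where e: "e > 0" "\<And>z. N (z - R x) < e \<Longrightarrow> z \<in> U"
        by auto
      have "R y \<in> U" if "dist y x < e / max K 1" for y
      proof (rule e(2))
        have "N (R y - R x) \<le> max K 1 * norm (y - x)"
          by (rule upper)
        also have "\<dots> < e"
          using that by (simp add: dist_norm field_simps)
        finally show "N (R y - R x) < e" .
      qed
      then show "\<exists>d>0. \<forall>y. dist y x < d \<longrightarrow> y \<in> {x. R x \<in> U}"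
        using e(1) by (intro exI[of _ "e / max K 1"]) auto
    qed
    then have "continuous_map euclidean (quasi_norm_topology N) R"
      by (simp add: continuous_map_def)
    then show "continuous_map euclidean (subtopology (quasi_norm_topology N) (range R)) R"
      by (simp add: continuous_map_in_subtopology)
    show "open_map euclidean (subtopology (quasi_norm_topology N) (range R)) R"
      unfolding open_map_def
    proof (intro allI impI openin_subtopology_quasi_normI)
      fix U y
      assume "openin euclidean U" "y \<in> R ` U"
      then obtain x where x: "y = R x" "x \<in> U"
        by blast
      then have "\<exists>d>0. \<forall>z. dist z x < d \<longrightarrow> z \<in> U"
        using \<open>openin euclidean U\<close> by (simp add: open_openin[symmetric] open_dist)
      then obtain d where d: "d > 0" "\<And>z. dist z x < d \<Longrightarrow> z \<in> U"
        by blast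
      have "R z \<in> R ` U" if "N (R z - y) < c * d" for z
      proof -
        have "c * norm (z - x) < c * d"
          using c(2)[of "z - x"] that by (simp add: x diff)
        then have "norm (z - x) < d"
          using c(1) by simp
        then show ?thesis
          using d(2) by (simp add: dist_norm)
      qed
      then show "\<exists>e>0. \<forall>z\<in>range R. N (z - y) < e \<longrightarrow> z \<in> R ` U"
        using d(1) c(1) by (intro exI[of _ "c * d"]) auto
    qed auto
  qed (use inj in auto)
  ultimately show ?thesis
    using lin sup inf by blast
qed

end

section \<open>Normalising order isomorphisms, and the conclusion\<close>

lemma order_isomorphic_sym: "order_isomorphic A B \<Longrightarrow> order_isomorphic B A"
  unfolding order_isomorphic_def
proof (elim exE conjE)
  fix T
  assume T: "bij_betw T A B" "\<forall>x\<in>A. \<forall>y\<in>A. (x \<ge> y) = (T x \<ge> T y)"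
  show "\<exists>T. bij_betw T B A \<and> (\<forall>x\<in>B. \<forall>y\<in>B. (x \<ge> y) = (T x \<ge> T y))"
  proof (intro exI conjI ballI)
    show "bij_betw (inv_into A T) B A"
      using T(1) by (rule bij_betw_inv_into)
    fix x y
    assume "x \<in> B" "y \<in> B"
    then show "(x \<ge> y) = (inv_into A T x \<ge> inv_into A T y)"
      using T bij_betw_inv_into_right[OF T(1)] bij_betw_imp_surj_on[OF T(1)]
      by (metis inv_into_into)
  qed
qed

text \<open>Subtracting \<open>T 0\<close> gives the normalisation at 0; as \<open>T 0\<close> lies
  in the subspace \<open>G\<close>, this translation maps \<open>G\<close> onto itself.\<close>

lemma order_isomorphic_imp_order_iso_onto:
  assumes "order_isomorphic (UNIV :: 'a::vector_lattice set) (G :: 'b::vector_lattice set)" "sublattice G"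
  obtains T :: "'a::vector_lattice \<Rightarrow> 'b::vector_lattice" where "order_iso_onto T G"
proof -
  obtain T :: "'a \<Rightarrow> 'b" where T: "bij_betw T UNIV G" "\<And>x y. T x \<le> T y \<longleftrightarrow> x \<le> y"
    using assms(1) unfolding order_isomorphic_def by auto
  have sub: "subspace G"
    using assms(2) by (simp add: sublattice_def)
  have "T 0 \<in> G"
    using T(1) by (auto simp: bij_betw_def)
  have "bij_betw (\<lambda>y. y - T 0) G G"
    by (rule bij_betw_byWitness[where f' = "\<lambda>y. y + T 0"])
      (use sub \<open>T 0 \<in> G\<close> in \<open>auto intro: subspace_diff subspace_add\<close>)
  then have "bij_betw (\<lambda>x. T x - T 0) UNIV G"
    using bij_betw_trans[OF T(1)] by (simp add: o_def)
  then have "order_iso_onto (\<lambda>x. T x - T 0) G"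
    using T(2) assms(2) by unfold_locales auto
  then show ?thesis
    by (rule that)
qed

lemma c0_basis_order_isomorphic:
  fixes NE :: "'e::vector_lattice \<Rightarrow> real" and NF :: "'f::vector_lattice \<Rightarrow> real"
  assumes "quasi_banach_lattice NE" "quasi_banach_lattice NF"
    and "order_isomorphic (UNIV :: 'e set) G" "sublattice G" "closedin (quasi_norm_topology NF) G"
    and "quasi_banach_lattice.c0_basis NE e"
  shows "\<exists>f. quasi_banach_lattice.c0_basis NF f"
proof -
  obtain T :: "'e \<Rightarrow> 'f" where "order_iso_onto T G"
    using order_isomorphic_imp_order_iso_onto[OF assms(3,4)] by blast
  then interpret banach_order_iso NE NF T G
    using assms by (intro banach_order_iso.intro banach_order_iso_axioms.intro)
  show ?thesis
    using assms(6) by (rule c0_basis_transfer)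
qed

theorem theorem6:
  fixes NE :: "'e::vector_lattice \<Rightarrow> real"
    and NF :: "'f::vector_lattice \<Rightarrow> real"
  assumes "quasi_banach_lattice NE"
    and "quasi_banach_lattice NF"
    and "order_isomorphic (UNIV :: 'e set) (UNIV :: 'f set)"
    and "\<exists>G. sublattice G \<and> closedin (quasi_norm_topology NE) G
           \<and> order_isomorphic G (UNIV :: c0 set)"
  shows "\<exists>H. sublattice H \<and> closedin (quasi_norm_topology NF) H
           \<and> (\<exists>R :: c0 \<Rightarrow> 'f. linear R \<and> bij_betw R UNIV H
                \<and> (\<forall>x y. R (sup x y) = sup (R x) (R y) \<and> R (inf x y) = inf (R x) (R y))
                \<and> homeomorphic_map euclidean (subtopology (quasi_norm_topology NF) H) R)"
proof -
  obtain G where G: "sublattice G" "closedin (quasi_norm_topology NE) G"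
    and iso: "order_isomorphic G (UNIV :: c0 set)"
    using assms(4) by blast
  \<comment> \<open>The given isomorphism runs from \<open>G\<close> to \<open>c0\<close>; its
    inverse carries the existence of a basis from \<open>c0\<close> to the first lattice.\<close>
  obtain e where e: "quasi_banach_lattice.c0_basis NE e"
    using c0_basis_order_isomorphic[OF quasi_banach_lattice_c0 assms(1)
      order_isomorphic_sym[OF iso] G c0_basis_c0_unit] by blast
  have "sublattice (UNIV :: 'f set)"
    by (simp add: sublattice_def)
  moreover have "closedin (quasi_norm_topology NF) UNIV"
    using closedin_topspace[of "quasi_norm_topology NF"] by simp
  ultimately obtain f where "quasi_banach_lattice.c0_basis NF f"
    using c0_basis_order_isomorphic[OF assms(1-3) _ _ e] by blast
  then show ?thesis
    by (rule quasi_banach_lattice.c0_basis_imp_sublattice[OF assms(2)])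
qed

end
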